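(* Let $M,N\ge 3$ be integers and let $0<p_m<1$ for $m=0,1,2,3,4$, so that the Markov chain in $\Sigma^\circ$ with one-step transition matrix $\boldsymbol P^\circ$ is ergodic, and let the row vector $\boldsymbol\pi^\circ$ be its unique stationary distribution. Define $$\mu^\circ=\boldsymbol\pi^\circ\dot{\boldsymbol P}^\circ\boldsymbol 1,\qquad (\sigma^\circ)^2=\boldsymbol\pi^\circ\ddot{\boldsymbol P}^\circ\boldsymbol 1-(\boldsymbol\pi^\circ\dot{\boldsymbol P}^\circ\boldsymbol 1)^2+2\,\boldsymbol\pi^\circ\dot{\boldsymbol P}^\circ(\boldsymbol Z^\circ-\boldsymbol 1\boldsymbol\pi^\circ)\dot{\boldsymbol P}^\circ\boldsymbol 1,$$ where $\boldsymbol 1$ denotes the column vector of $1$s with entries indexed by $\Sigma^\circ$ and $\boldsymbol Z^\circ:=(\boldsymbol I-(\boldsymbol P^\circ-\boldsymbol 1\boldsymbol\pi^\circ))^{-1}$ is the fundamental matrix. Let $\{X_n^\circ\}_{n\ge0}$ be a time-homogeneous Markov chain in $\Sigma^\circ$ with one-step transition matrix $\boldsymbol P^\circ$, and let the initial distribution be arbitrary. For each $n\ge1$, define $\xi_n:=w^\circ(X_{n-1}^\circ,X_n^\circ)$ and $S_n:=\xi_1+\cdots+\xi_n$. Then $\lim_{n\to\infty}n^{-1}S_n=\mu^\circ$ almost surely and, if $(\sigma^\circ)^2>0$, then $$\frac{S_n-n\mu^\circ}{\sqrt{n(\sigma^\circ)^2}}\to N(0,1)\quad\text{in distribution as } n\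to\infty.$$
   Context: Setting. $M,N\ge3$; $\Sigma:=\{0,1\}^{MN}$ is the set of $M\times N$ arrays $\boldsymbol x=(x_{i,j})$ of 0s and 1s. Indices are periodic: first subscripts $M+1$ and $0$ mean $1$ and $M$; second subscripts $N+1$ and $0$ mean $1$ and $N$. Put $m_{i,j}(\boldsymbol x):=x_{i+1,j}+x_{i-1,j}+x_{i,j+1}+x_{i,j-1}\in\{0,1,2,3,4\}$, and let $\boldsymbol x^{i,j}$ be the array equal to $\boldsymbol x$ except that the entry at $(i,j)$ is changed. Parameters are $p_0,\dots,p_4\in[0,1]$, and $q_m:=1-p_m$. Augmented chain. $\Sigma^\circ:=\Sigma\times\{-1,1\}$ (the second component records the profit from the last game played). The one-step transition matrix $\boldsymbol P^\circ$ on $\Sigma^\circ$ is given, for every $(\boldsymbol x,s)\in\Sigma^\circ$ and all $1\le i\le M$, $1\le j\le N$, by - $P^\circ((\boldsymbol x,s),(\boldsymbol x^{i,j},1)):=(MN)^{-1}p_{m_{i,j}(\boldsymbol x)}$ if $x_{i,j}=0$, and $0$ if $x_{i,j}=1$; - $P^\circ((\boldsymbol x,s),(\boldsymbol x^{i,j},-1)):=0$ if $x_{i,j}=0$, and $(MN)^{-1}q_{m_{i,j}(\boldsymbol x)}$ if $x_{i,j}=1$; - $P^\circ((\boldsymbol x,s),(\boldsymbol x,1)):=(MN)^{-1}\sum_{i,j:\,x_{i,j}=1}p_{m_{i,j}(\boldsymbol x)}$; - $P^\circ((\boldsymbol x,s),(\boldsymbol x,-1)):=(MN)^{-1}\sum_{i,j:\,x_{i,j}=0}q_{m_{i,j}(\boldsymbol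 x)}$; with all other entries $0$ (empty sums are $0$). The two states $(\boldsymbol 0,1)$ and $(\boldsymbol 1,-1)$ (all-0s array with $s=1$; all-1s array with $s=-1$) are inaccessible; they are kept in the state space, and "ergodic" means that the chain is irreducible and aperiodic once these two states are excluded. The stationary distribution $\boldsymbol\pi^\circ$ has entry $0$ at these two states. Payoff. $w^\circ((\boldsymbol x,s),(\boldsymbol x^{i,j},t))=t$ if $x_{i,j}=(1-t)/2$, and $w^\circ((\boldsymbol x,s),(\boldsymbol x,t))=t$, for all $(\boldsymbol x,s)\in\Sigma^\circ$, all $i,j$, and $t\in\{-1,1\}$; $w^\circ=0$ otherwise. $\boldsymbol W^\circ$ is the matrix with entries given by $w^\circ$; $\dot{\boldsymbol P}^\circ:=\boldsymbol P^\circ\circ\boldsymbol W^\circ$ and $\ddot{\boldsymbol P}^\circ:=\boldsymbol P^\circ\circ\boldsymbol W^\circ\circ\boldsymbol W^\circ$, where $\circ$ between matrices is the Hadamard (entrywise) product. *)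

theory Defs
  imports "HOL-Probability.Probability"
begin

section \<open>Matrices and vectors indexed by a finite set\<close>

text \<open>
  The state space of the chain depends on two natural numbers, so matrices and vectors are
  functions together with an explicit finite index set \<open>S\<close>; only entries with indices in \<open>S\<close> matter.
\<close>

definition mat_one :: "'a \<Rightarrow> 'a \<Rightarrow> real" where
  "mat_one a b = (if a = b then 1 else 0)"

definition mat_mult :: "'a set \<Rightarrow> ('a \<Rightarrow> 'a \<Rightarrow> real) \<Rightarrow> ('a \<Rightarrow> 'a \<Rightarrow> real) \<Rightarrow> 'a \<Rightarrow> 'a \<Rightarrow> real" where
  "mat_mult S A B a c = (\<Sum>b\<in>S. A a b * B b c)"

primrec mat_pow :: "'a set \<Rightarrow> ('a \<Rightarrow> 'a \<Rightarrow> real) \<Rightarrow> nat \<Rightarrow> 'a \<Rightarrow> 'a \<Rightarrow> real" where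
  "mat_pow S A 0 = mat_one"
| "mat_pow S A (Suc n) = mat_mult S (mat_pow S A n) A"

definition hadamard :: "('a \<Rightarrow> 'a \<Rightarrow> real) \<Rightarrow> ('a \<Rightarrow> 'a \<Rightarrow> real) \<Rightarrow> 'a \<Rightarrow> 'a \<Rightarrow> real" where
  "hadamard A B a b = A a b * B a b"

definition vec_mat :: "'a set \<Rightarrow> ('a \<Rightarrow> real) \<Rightarrow> ('a \<Rightarrow> 'a \<Rightarrow> real) \<Rightarrow> 'a \<Rightarrow> real" where
  "vec_mat S v A b = (\<Sum>a\<in>S. v a * A a b)"

definition row_col :: "'a set \<Rightarrow> ('a \<Rightarrow> real) \<Rightarrow> ('a \<Rightarrow> real) \<Rightarrow> real" where
  "row_col S u v = (\<Sum>a\<in>S. u a * v a)"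

definition is_mat_inverse :: "'a set \<Rightarrow> ('a \<Rightarrow> 'a \<Rightarrow> real) \<Rightarrow> ('a \<Rightarrow> 'a \<Rightarrow> real) \<Rightarrow> bool" where
  "is_mat_inverse S A B \<longleftrightarrow>
     (\<forall>a\<in>S. \<forall>b\<in>S. mat_mult S A B a b = mat_one a b \<and> mat_mult S B A a b = mat_one a b)"

definition mat_invertible :: "'a set \<Rightarrow> ('a \<Rightarrow> 'a \<Rightarrow> real) \<Rightarrow> bool" where
  "mat_invertible S A \<longleftrightarrow> (\<exists>B. is_mat_inverse S A B)"

text \<open>For invertible \<open>A\<close> the entries of the inverse with indices in \<open>S\<close> are uniquely determined.\<close>

definition mat_inverse :: "'a set \<Rightarrow> ('a \<Rightarrow> 'a \<Rightarrow> real) \<Rightarrow> 'a \<Rightarrow> 'a \<Rightarrow> real" where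
  "mat_inverse S A = (SOME B. is_mat_inverse S A B)"


section \<open>Finite Markov chains\<close>

text \<open>The last conjunct only normalises the function outside \<open>S\<close>, so that uniqueness of a
  stationary distribution can be expressed as \<open>\<exists>!\<close>.\<close>

definition stationary_distribution :: "'a set \<Rightarrow> ('a \<Rightarrow> 'a \<Rightarrow> real) \<Rightarrow> ('a \<Rightarrow> real) \<Rightarrow> bool" where
  "stationary_distribution S P \<pi> \<longleftrightarrow>
     (\<forall>a\<in>S. 0 \<le> \<pi> a) \<and> (\<Sum>a\<in>S. \<pi> a) = 1 \<and> (\<forall>b\<in>S. vec_mat S \<pi> P b = \<pi> b) \<and>
     (\<forall>a. a \<notin> S \<longrightarrow> \<pi> a = 0)"

definition irreducible_chain :: "'a set \<Rightarrow> ('a \<Rightarrow> 'a \<Rightarrow> real) \<Rightarrow> bool" where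
  "irreducible_chain S P \<longleftrightarrow> (\<forall>a\<in>S. \<forall>b\<in>S. \<exists>n. mat_pow S P n a b > 0)"

definition aperiodic_chain :: "'a set \<Rightarrow> ('a \<Rightarrow> 'a \<Rightarrow> real) \<Rightarrow> bool" where
  "aperiodic_chain S P \<longleftrightarrow> (\<forall>a\<in>S. Gcd {n. n > 0 \<and> mat_pow S P n a a > 0} = 1)"

text \<open>\<open>I - (P - 1 \<pi>)\<close>, where \<open>1 \<pi>\<close> is the matrix all of whose rows are \<open>\<pi>\<close>.\<close>

definition fundamental_base :: "('a \<Rightarrow> 'a \<Rightarrow> real) \<Rightarrow> ('a \<Rightarrow> real) \<Rightarrow> 'a \<Rightarrow> 'a \<Rightarrow> real" where
  "fundamental_base P \<pi> a b = mat_one a b - (P a b - \<pi> b)"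

definition fundamental_matrix ::
    "'a set \<Rightarrow> ('a \<Rightarrow> 'a \<Rightarrow> real) \<Rightarrow> ('a \<Rightarrow> real) \<Rightarrow> 'a \<Rightarrow> 'a \<Rightarrow> real" where
  "fundamental_matrix S P \<pi> = mat_inverse S (fundamental_base P \<pi>)"

definition mean_param ::
    "'a set \<Rightarrow> ('a \<Rightarrow> 'a \<Rightarrow> real) \<Rightarrow> ('a \<Rightarrow> 'a \<Rightarrow> real) \<Rightarrow> ('a \<Rightarrow> real) \<Rightarrow> real" where
  "mean_param S P W \<pi> = row_col S (vec_mat S \<pi> (hadamard P W)) (\<lambda>_. 1)"

definition variance_param ::
    "'a set \<Rightarrow> ('a \<Rightarrow> 'a \<Rightarrow> real) \<Rightarrow> ('a \<Rightarrow> 'a \<Rightarrow> real) \<Rightarrow> ('a \<Rightarrow> real) \<Rightarrow> real" where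
  "variance_param S P W \<pi> =
     (let P1 = hadamard P W;
          P2 = hadamard (hadamard P W) W;
          Z = fundamental_matrix S P \<pi>
      in row_col S (vec_mat S \<pi> P2) (\<lambda>_. 1)
         - (row_col S (vec_mat S \<pi> P1) (\<lambda>_. 1))\<^sup>2
         + 2 * row_col S (vec_mat S (vec_mat S (vec_mat S \<pi> P1) (\<lambda>a b. Z a b - \<pi> b)) P1) (\<lambda>_. 1))"

text \<open>The initial distribution, i.e. the law of \<open>X 0\<close>, is not constrained.\<close>

definition markov_chain ::
    "'w measure \<Rightarrow> 'a set \<Rightarrow> ('a \<Rightarrow> 'a \<Rightarrow> real) \<Rightarrow> (nat \<Rightarrow> 'w \<Rightarrow> 'a) \<Rightarrow> bool" where
  "markov_chain \<Omega> S P X \<longleftrightarrow>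
     prob_space \<Omega> \<and>
     (\<forall>n. X n \<in> measurable \<Omega> (count_space S)) \<and>
     (\<forall>n a. (\<forall>i\<le>Suc n. a i \<in> S) \<longrightarrow>
        \<P>(\<omega> in \<Omega>. \<forall>i\<le>n. X i \<omega> = a i) > 0 \<longrightarrow>
        \<P>(\<omega> in \<Omega>. X (Suc n) \<omega> = a (Suc n) \<bar> \<forall>i\<le>n. X i \<omega> = a i) = P (a n) (a (Suc n)))"


section \<open>The augmented chain on the torus\<close>

type_synonym site = "nat \<times> nat"
type_synonym config = "site \<Rightarrow> nat"

definition sites :: "nat \<Rightarrow> nat \<Rightarrow> site set" where
  "sites M N = {1..M} \<times> {1..N}"

definition configs :: "nat \<Rightarrow> nat \<Rightarrow> config set" where
  "configs M N = sites M N \<rightarrow>\<^sub>E {0, 1}"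

definition aug_states :: "nat \<Rightarrow> nat \<Rightarrow> (config \<times> int) set" where
  "aug_states M N = configs M N \<times> {-1, 1}"

definition const_config :: "nat \<Rightarrow> nat \<Rightarrow> nat \<Rightarrow> config" where
  "const_config M N c = (\<lambda>k\<in>sites M N. c)"

definition accessible_states :: "nat \<Rightarrow> nat \<Rightarrow> (config \<times> int) set" where
  "accessible_states M N = aug_states M N - {(const_config M N 0, 1), (const_config M N 1, -1)}"

definition cyc_next :: "nat \<Rightarrow> nat \<Rightarrow> nat" where
  "cyc_next L i = (if i = L then 1 else i + 1)"

definition cyc_prev :: "nat \<Rightarrow> nat \<Rightarrow> nat" where
  "cyc_prev L i = (if i = 1 then L else i - 1)"

definition neighbour_sum :: "nat \<Rightarrow> nat \<Rightarrow> config \<Rightarrow> site \<Rightarrow> nat" where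
  "neighbour_sum M N x = (\<lambda>(i, j).
     x (cyc_next M i, j) + x (cyc_prev M i, j) + x (i, cyc_next N j) + x (i, cyc_prev N j))"

definition flip :: "config \<Rightarrow> site \<Rightarrow> config" where
  "flip x k = x(k := 1 - x k)"

text \<open>
  In the case \<open>y \<noteq> x\<close> the sum has exactly one summand if \<open>y\<close> arises from \<open>x\<close> by changing
  one entry, and is empty otherwise; see the lemmas below.
\<close>

definition aug_trans ::
    "nat \<Rightarrow> nat \<Rightarrow> (nat \<Rightarrow> real) \<Rightarrow> config \<times> int \<Rightarrow> config \<times> int \<Rightarrow> real" where
  "aug_trans M N p = (\<lambda>(x, s) (y, t).
     (if y = x then
        (if t = 1 then \<Sum>k\<in>{k \<in> sites M N. x k = 1}. p (neighbour_sum M N x k)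
         else \<Sum>k\<in>{k \<in> sites M N. x k = 0}. 1 - p (neighbour_sum M N x k))
      else
        (\<Sum>k\<in>{k \<in> sites M N. y = flip x k}.
           if t = 1 then (if x k = 0 then p (neighbour_sum M N x k) else 0)
           else (if x k = 0 then 0 else 1 - p (neighbour_sum M N x k))))
     / real (M * N))"

definition aug_payoff :: "nat \<Rightarrow> nat \<Rightarrow> config \<times> int \<Rightarrow> config \<times> int \<Rightarrow> real" where
  "aug_payoff M N = (\<lambda>(x, s) (y, t).
     if y = x \<or> (\<exists>k\<in>sites M N. y = flip x k \<and> real (x k) = (1 - real_of_int t) / 2)
     then real_of_int t else 0)"

lemma flip_neq: "flip x k \<noteq> x"
proof
  assume "flip x k = x"
  then have "1 - x k = x k"
    unfolding flip_def by (metis fun_upd_same)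
  then show False by arith
qed

lemma flip_eq_iff: "flip x k = flip x l \<longleftrightarrow> k = l"
proof
  assume eq: "flip x k = flip x l"
  show "k = l"
  proof (rule ccontr)
    assume "k \<noteq> l"
    then have "1 - x k = x k"
      using fun_cong[OF eq, of k] by (simp add: flip_def)
    then show False by arith
  qed
qed simp

lemma aug_trans_flip_pos:
  assumes "k \<in> sites M N"
  shows "aug_trans M N p (x, s) (flip x k, 1) =
           (if x k = 0 then p (neighbour_sum M N x k) / real (M * N) else 0)"
proof -
  have "{l \<in> sites M N. flip x k = flip x l} = {k}"
    using assms by (auto simp: flip_eq_iff)
  then show ?thesis by (simp add: aug_trans_def flip_neq)
qed

lemma aug_trans_flip_neg:
  assumes "k \<in> sites M N"
  shows "aug_trans M N p (x, s) (flip x k, -1) =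
           (if x k = 0 then 0 else (1 - p (neighbour_sum M N x k)) / real (M * N))"
proof -
  have "{l \<in> sites M N. flip x k = flip x l} = {k}"
    using assms by (auto simp: flip_eq_iff)
  then show ?thesis by (simp add: aug_trans_def flip_neq)
qed

lemma aug_trans_other:
  assumes "y \<noteq> x" "\<And>k. k \<in> sites M N \<Longrightarrow> y \<noteq> flip x k"
  shows "aug_trans M N p (x, s) (y, t) = 0"
proof -
  have "{k \<in> sites M N. y = flip x k} = {}"
    using assms(2) by auto
  then show ?thesis
    using assms(1) unfolding aug_trans_def by (simp only: prod.case if_False sum.empty div_0)
qed

end

theory Submission
  imports Defs
begin

text \<open>
  Every accessible state of the torus chain has a self-loop and can be reached from everywhere by
  single flips, so some power of the matrix has a positive column. This makes the oscillation of
  the columns of the powers decay geometrically, which yields the stationary distribution and the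
  inverse of \<open>I - (P - 1 \<pi>)\<close> as a Neumann series.

  With \<open>f(a) = \<Sum>\<^sub>b P(a,b) w(a,b)\<close> and \<open>g = (Z - 1 \<pi>) f\<close>, the Poisson equation \<open>g - P g = f - \<mu>\<close>
  shows that \<open>w(X\<^sub>k, X\<^sub>k\<^sub>+\<^sub>1) - \<mu> + g(X\<^sub>k\<^sub>+\<^sub>1) - g(X\<^sub>k)\<close> are bounded martingale differences, whose
  stationary variance is \<open>\<sigma>\<^sup>2\<close>; their partial sums differ from \<open>S\<^sub>n - n \<mu>\<close> by a bounded term.
  The strong law follows from a fourth moment bound of order \<open>n\<^sup>2\<close>. For the central limit theorem a
  second Poisson equation replaces the conditional variances by their stationary mean up to an
  error \<open>O(n\<^sup>-\<^sup>3\<^sup>/\<^sup>2)\<close> per step, so the characteristic functions converge.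
\<close>

section \<open>Stochastic matrices\<close>

lemma mat_mult_one_left:
  assumes "finite S" "a \<in> S"
  shows "mat_mult S mat_one A a c = A a c"
  using assms by (simp add: mat_mult_def mat_one_def if_distrib[of "\<lambda>x. x * _"] cong: if_cong)

lemma mat_mult_one_right:
  assumes "finite S" "c \<in> S"
  shows "mat_mult S A mat_one a c = A a c"
  using assms by (simp add: mat_mult_def mat_one_def if_distrib[of "\<lambda>x. _ * x"] cong: if_cong)

lemma mat_mult_assoc:
  "mat_mult S (mat_mult S A B) C a d = mat_mult S A (mat_mult S B C) a d"
  unfolding mat_mult_def sum_distrib_left sum_distrib_right
  by (subst sum.swap) (simp add: mult.assoc)

lemma mat_pow_add:
  assumes "finite S" "a \<in> S" "c \<in> S"
  shows "mat_pow S A (m + n) a c = mat_mult S (mat_pow S A m) (mat_pow S A n) a c"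
  using assms(3)
proof (induction n arbitrary: c)
  case 0
  then show ?case using assms by (simp add: mat_mult_one_right)
next
  case (Suc n)
  have "mat_pow S A (m + Suc n) a c = (\<Sum>b\<in>S. mat_pow S A (m + n) a b * A b c)"
    by (simp add: mat_mult_def)
  also have "\<dots> = (\<Sum>b\<in>S. mat_mult S (mat_pow S A m) (mat_pow S A n) a b * A b c)"
    by (intro sum.cong refl arg_cong2[of _ _ _ _ "(*)"] Suc.IH)
  also have "\<dots> = mat_mult S (mat_mult S (mat_pow S A m) (mat_pow S A n)) A a c"
    by (simp add: mat_mult_def)
  finally show ?case by (simp add: mat_mult_assoc)
qed

lemma mat_pow_Suc_left:
  assumes "finite S" "a \<in> S" "c \<in> S"
  shows "mat_pow S A (Suc n) a c = (\<Sum>b\<in>S. A a b * mat_pow S A n b c)"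
proof -
  have "mat_pow S A (Suc n) a c = mat_mult S (mat_pow S A 1) (mat_pow S A n) a c"
    using mat_pow_add[OF assms, of A 1 n] by simp
  then show ?thesis
    using assms by (simp add: mat_mult_def[of _ "mat_mult _ _ _"] mat_mult_one_left)
qed

lemma mat_pow_nonneg:
  assumes "\<And>a b. a \<in> S \<Longrightarrow> b \<in> S \<Longrightarrow> 0 \<le> A a b" "b \<in> S"
  shows "0 \<le> mat_pow S A n a b"
  using assms(2)
proof (induction n arbitrary: b)
  case 0
  then show ?case by (simp add: mat_one_def)
next
  case (Suc n)
  then show ?case by (auto simp: mat_mult_def intro!: sum_nonneg mult_nonneg_nonneg assms(1))
qed

text \<open>All summands of the matrix product are nonnegative, so the single path through
  \<open>b\<close> already makes the entry positive. Reachability is built up one step at a time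
  with this.\<close>

lemma mat_pow_step_pos:
  assumes "finite S" "\<And>a b. a \<in> S \<Longrightarrow> b \<in> S \<Longrightarrow> 0 \<le> A a b"
    and "b \<in> S" "c \<in> S" "mat_pow S A n a b > 0" "A b c > 0"
  shows "mat_pow S A (Suc n) a c > 0"
proof -
  have "0 < mat_pow S A n a b * A b c" using assms by simp
  also have "\<dots> \<le> (\<Sum>b\<in>S. mat_pow S A n a b * A b c)"
    using assms by (intro member_le_sum[of b S "\<lambda>b. mat_pow S A n a b * A b c"] mult_nonneg_nonneg mat_pow_nonneg) auto
  finally show ?thesis by (simp add: mat_mult_def)
qed

lemma is_mat_inverse_mat_inverse:
  assumes "mat_invertible S A"
  shows "is_mat_inverse S A (mat_inverse S A)"
  using assms unfolding mat_invertible_def mat_inverse_def by (rule someI_ex)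

locale stochastic_matrix =
  fixes S :: "'a set" and P :: "'a \<Rightarrow> 'a \<Rightarrow> real"
  assumes finite_states: "finite S"
    and nonneg: "\<And>a b. a \<in> S \<Longrightarrow> b \<in> S \<Longrightarrow> 0 \<le> P a b"
    and row_sum: "\<And>a. a \<in> S \<Longrightarrow> (\<Sum>b\<in>S. P a b) = 1"
begin

lemma pow_nonneg: "b \<in> S \<Longrightarrow> 0 \<le> mat_pow S P n a b"
  by (rule mat_pow_nonneg[OF nonneg])

lemma pow_row_sum: "a \<in> S \<Longrightarrow> (\<Sum>b\<in>S. mat_pow S P n a b) = 1"
proof (induction n)
  case 0
  then show ?case using finite_states by (simp add: mat_one_def)
next
  case (Suc n)
  have "(\<Sum>b\<in>S. mat_pow S P (Suc n) a b) = (\<Sum>c\<in>S. mat_pow S P n a c * (\<Sum>b\<in>S. P c b))"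
    unfolding mat_pow.simps mat_mult_def sum_distrib_left by (rule sum.swap)
  then show ?case using Suc by (simp add: row_sum)
qed

lemma stationary_pow:
  assumes "stationary_distribution S P \<pi>" "b \<in> S"
  shows "(\<Sum>a\<in>S. \<pi> a * mat_pow S P n a b) = \<pi> b"
  using assms(2)
proof (induction n arbitrary: b)
  case 0
  then show ?case using mat_mult_one_right[OF finite_states 0, of "\<lambda>_. \<pi>"]
    by (simp add: mat_mult_def)
next
  case (Suc n)
  have "(\<Sum>a\<in>S. \<pi> a * mat_pow S P (Suc n) a b)
      = (\<Sum>c\<in>S. (\<Sum>a\<in>S. \<pi> a * mat_pow S P n a c) * P c b)"
    unfolding mat_pow.simps mat_mult_def sum_distrib_left sum_distrib_right
    by (subst sum.swap) (simp add: mult.assoc)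
  also have "\<dots> = \<pi> b"
    using Suc assms(1) by (simp add: stationary_distribution_def vec_mat_def)
  finally show ?case .
qed

text \<open>Invariance in the form used for second moments: under \<open>\<pi>\<close>, averaging a
  function after one step is the same as averaging it now.\<close>

lemma stationary_sum:
  assumes "stationary_distribution S P \<pi>"
  shows "(\<Sum>a\<in>S. \<pi> a * (\<Sum>b\<in>S. P a b * f b)) = (\<Sum>b\<in>S. \<pi> b * f b)"
proof -
  have "(\<Sum>a\<in>S. \<pi> a * (\<Sum>b\<in>S. P a b * f b)) = (\<Sum>b\<in>S. vec_mat S \<pi> P b * f b)"
    unfolding vec_mat_def sum_distrib_left sum_distrib_right
    by (subst sum.swap) (simp add: mult.assoc)
  then show ?thesis using assms by (simp add: stationary_distribution_def)
qed

text \<open>The rows of each power are probability vectors, so an average along a row cannot leave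
  the range of \<open>f\<close>.\<close>

lemma average_bounds:
  assumes "a \<in> S" "\<And>c. c \<in> S \<Longrightarrow> l \<le> f c" "\<And>c. c \<in> S \<Longrightarrow> f c \<le> u"
  shows "l \<le> (\<Sum>c\<in>S. mat_pow S P n a c * f c)" "(\<Sum>c\<in>S. mat_pow S P n a c * f c) \<le> u"
proof -
  have "l = (\<Sum>c\<in>S. mat_pow S P n a c * l)" "u = (\<Sum>c\<in>S. mat_pow S P n a c * u)"
    using pow_row_sum[OF assms(1), of n] by (simp_all add: sum_distrib_right[symmetric])
  then show "l \<le> (\<Sum>c\<in>S. mat_pow S P n a c * f c)" "(\<Sum>c\<in>S. mat_pow S P n a c * f c) \<le> u"
    using assms pow_nonneg by (metis (no_types, lifting) sum_mono mult_left_mono)+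
qed

text \<open>The function \<open>h = Z f\<close> solves \<open>h - P h + \<pi> h = f\<close>; applying \<open>\<pi>\<close> to this equation gives
  \<open>\<pi> h = \<pi> f\<close>, so \<open>g = h - \<pi> f\<close>.\<close>

lemma poisson_equation:
  fixes f :: "'a \<Rightarrow> real"
  assumes st: "stationary_distribution S P \<pi>"
    and inv: "is_mat_inverse S (fundamental_base P \<pi>) Z"
  defines "g \<equiv> \<lambda>a. \<Sum>b\<in>S. (Z a b - \<pi> b) * f b"
  shows "a \<in> S \<Longrightarrow> g a - (\<Sum>b\<in>S. P a b * g b) = f a - (\<Sum>b\<in>S. \<pi> b * f b)"
    and "(\<Sum>a\<in>S. \<pi> a * g a) = 0"
proof -
  define h where "h = (\<lambda>a. \<Sum>b\<in>S. Z a b * f b)"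
  define \<mu> where "\<mu> = (\<Sum>b\<in>S. \<pi> b * f b)"
  have sum_pi: "(\<Sum>a\<in>S. \<pi> a) = 1" using st by (simp add: stationary_distribution_def)
  have one: "(\<Sum>b\<in>S. mat_one a b * F b) = F a" if "a \<in> S" for a F
    using mat_mult_one_left[OF finite_states that, of "\<lambda>b _. F b"] by (simp add: mat_mult_def)
  have eq: "h a - (\<Sum>b\<in>S. P a b * h b) + (\<Sum>b\<in>S. \<pi> b * h b) = f a" if a: "a \<in> S" for a
  proof -
    have "(\<Sum>b\<in>S. fundamental_base P \<pi> a b * h b)
        = (\<Sum>c\<in>S. mat_mult S (fundamental_base P \<pi>) Z a c * f c)"
      unfolding h_def mat_mult_def sum_distrib_left sum_distrib_right
      by (subst sum.swap) (simp add: mult.assoc)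
    also have "\<dots> = (\<Sum>c\<in>S. mat_one a c * f c)"
      using inv a by (intro sum.cong) (auto simp: is_mat_inverse_def)
    finally show ?thesis
      using a by (simp add: one fundamental_base_def left_diff_distrib sum_subtractf)
  qed
  have "(\<Sum>a\<in>S. \<pi> a * (h a - (\<Sum>b\<in>S. P a b * h b) + (\<Sum>b\<in>S. \<pi> b * h b))) = \<mu>"
    unfolding \<mu>_def by (intro sum.cong) (auto simp: eq)
  then have pih: "(\<Sum>b\<in>S. \<pi> b * h b) = \<mu>"
    by (simp add: distrib_left right_diff_distrib sum.distrib sum_subtractf stationary_sum[OF st]
        sum_distrib_left[symmetric] sum_distrib_right[symmetric] sum_pi)
  have g: "g a = h a - \<mu>" for a
    by (simp add: g_def h_def \<mu>_def algebra_simps sum_subtractf)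
  show "g a - (\<Sum>b\<in>S. P a b * g b) = f a - (\<Sum>b\<in>S. \<pi> b * f b)" if "a \<in> S"
    using eq[OF that] row_sum[OF that]
    by (simp add: g pih right_diff_distrib sum_subtractf sum_distrib_right[symmetric] \<mu>_def[symmetric])
  show "(\<Sum>a\<in>S. \<pi> a * g a) = 0"
    by (simp add: g pih right_diff_distrib sum_subtractf sum_distrib_right[symmetric] sum_pi)
qed

end

section \<open>Doeblin minorization and geometric ergodicity\<close>

locale doeblin_matrix = stochastic_matrix +
  fixes m :: nat and b\<^sub>0 :: 'a
  assumes m_pos: "m > 0"
    and b\<^sub>0: "b\<^sub>0 \<in> S"
    and minorization: "\<And>a. a \<in> S \<Longrightarrow> mat_pow S P m a b\<^sub>0 > 0"
begin

text \<open>After \<open>m\<close> steps every row carries mass at least \<open>\<delta>\<close> at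
  \<open>b\<^sub>0\<close>. This common part contributes the same amount for all starting states, so
  only the remaining mass \<open>1 - \<delta>\<close> can produce differences within a column, and
  each block of \<open>m\<close> steps shrinks them by that factor.\<close>

lemma oscillation_decay:
  obtains \<delta> where "0 < \<delta>" "\<delta> < 1"
    "\<And>n b. b \<in> S \<Longrightarrow> \<exists>l. \<forall>a\<in>S. l \<le> mat_pow S P n a b \<and> mat_pow S P n a b \<le> l + (1 - \<delta>) ^ (n div m)"
proof -
  \<comment> \<open>The minimum is positive because \<open>S\<close> is finite and nonempty; the cap
    \<open>1 / 2\<close> keeps \<open>1 - \<delta>\<close> positive, which the later division and
    real power need.\<close>
  define \<delta> where "\<delta> = min (1 / 2) (Min ((\<lambda>a. mat_pow S P m a b\<^sub>0) ` S))"
  have ne: "S \<noteq> {}" using b\<^sub>0 by auto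
  have \<delta>: "0 < \<delta>" "\<delta> < 1"
    using ne finite_states minorization by (auto simp: \<delta>_def)
  have \<delta>_le: "\<delta> \<le> mat_pow S P m a b\<^sub>0" if "a \<in> S" for a
    unfolding \<delta>_def using that finite_states by (intro min.coboundedI2 Min_le) auto
  have contract: "\<exists>l'. \<forall>a\<in>S. l' \<le> (\<Sum>c\<in>S. mat_pow S P m a c * f c) \<and>
      (\<Sum>c\<in>S. mat_pow S P m a c * f c) \<le> l' + (1 - \<delta>) * d"
    if f: "\<forall>a\<in>S. l \<le> f a \<and> f a \<le> l + d" for f l d
  \<comment> \<open>The new lower bound mixes the shared value at \<open>b\<^sub>0\<close> with the
    old lower bound, the latter weighted by the mass \<open>1 - \<delta>\<close> of the remainder
    \<open>R\<close>.\<close>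
  proof (intro exI[of _ "\<delta> * f b\<^sub>0 + (1 - \<delta>) * l"] ballI)
    fix a assume a: "a \<in> S"
    define R where "R = (\<lambda>c. mat_pow S P m a c - \<delta> * mat_one b\<^sub>0 c)"
    have R: "0 \<le> R c" if "c \<in> S" for c
      using that \<delta>_le[OF a] pow_nonneg by (auto simp: R_def mat_one_def)
    have one: "(\<Sum>c\<in>S. mat_one b\<^sub>0 c * F c) = F b\<^sub>0" for F
      using mat_mult_one_left[OF finite_states b\<^sub>0, of "\<lambda>b _. F b"] by (simp add: mat_mult_def)
    have Rsum: "(\<Sum>c\<in>S. R c) = 1 - \<delta>"
      using one[of "\<lambda>_. 1"] pow_row_sum[OF a, of m]
      by (simp add: R_def sum_subtractf sum_distrib_left[symmetric])
    have "(\<Sum>c\<in>S. mat_pow S P m a c * f c) = \<delta> * f b\<^sub>0 + (\<Sum>c\<in>S. R c * f c)"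
      by (simp add: R_def left_diff_distrib sum_subtractf mult.assoc sum_distrib_left[symmetric] one)
    moreover have "(\<Sum>c\<in>S. R c * l) \<le> (\<Sum>c\<in>S. R c * f c)" "(\<Sum>c\<in>S. R c * f c) \<le> (\<Sum>c\<in>S. R c * (l + d))"
      using f R by (auto intro!: sum_mono mult_left_mono)
    ultimately show "\<delta> * f b\<^sub>0 + (1 - \<delta>) * l \<le> (\<Sum>c\<in>S. mat_pow S P m a c * f c) \<and>
      (\<Sum>c\<in>S. mat_pow S P m a c * f c) \<le> \<delta> * f b\<^sub>0 + (1 - \<delta>) * l + (1 - \<delta>) * d"
      unfolding sum_distrib_right[symmetric] Rsum by (simp add: algebra_simps)
  qed
  have "\<exists>l. \<forall>a\<in>S. l \<le> mat_pow S P n a b \<and> mat_pow S P n a b \<le> l + (1 - \<delta>) ^ (n div m)"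
    if b: "b \<in> S" for n b
  proof (induction n rule: less_induct)
    case (less n)
    show ?case
    proof (cases "n < m")
      case True
      \<comment> \<open>Here \<open>n div m = 0\<close>, so the interval from 0 to 1 is
        enough.\<close>
      have "mat_pow S P n a b \<le> 1" if "a \<in> S" for a
        using member_le_sum[of b S "mat_pow S P n a"] b finite_states pow_nonneg pow_row_sum[OF that, of n]
        by simp
      then show ?thesis using True b pow_nonneg by (intro exI[of _ 0]) auto
    next
      case False
      then obtain k where k: "n = m + k" using le_Suc_ex by (metis not_less)
      obtain l where l: "\<forall>a\<in>S. l \<le> mat_pow S P k a b \<and> mat_pow S P k a b \<le> l + (1 - \<delta>) ^ (k div m)"
        using less[of k] k m_pos by auto
      have "n div m = Suc (k div m)" using k m_pos by simp
      then show ?thesis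
        using contract[OF l] b by (simp add: k mat_pow_add[OF finite_states] mat_mult_def)
    qed
  qed
  with \<delta> that show thesis by blast
qed

text \<open>Rows of \<open>P^(k + n)\<close> are averages of rows of \<open>P^n\<close>, so from
  time \<open>n\<close> on a column stays in an interval of length
  \<open>(1 - \<delta>) ^ (n div m)\<close>. Hence the row of \<open>b\<^sub>0\<close> is Cauchy,
  its limit serves every starting state, and passing to the limit in the recursion for powers makes
  it stationary.\<close>

lemma geometric_ergodicity:
  obtains \<pi> C r where "stationary_distribution S P \<pi>" "0 < r" "r < 1"
    "\<And>a b n. a \<in> S \<Longrightarrow> b \<in> S \<Longrightarrow> \<bar>mat_pow S P n a b - \<pi> b\<bar> \<le> C * r ^ n"
proof -
  obtain \<delta> where \<delta>: "0 < \<delta>" "\<delta> < 1" and osc: "\<And>n b. b \<in> S \<Longrightarrow>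
      \<exists>l. \<forall>a\<in>S. l \<le> mat_pow S P n a b \<and> mat_pow S P n a b \<le> l + (1 - \<delta>) ^ (n div m)"
    using oscillation_decay by blast
  \<comment> \<open>This turns the contraction per block of \<open>m\<close> steps into a rate per
    step; the factor \<open>1 / (1 - \<delta>)\<close> below pays for the rounding in
    \<open>n div m\<close>.\<close>
  define r where "r = (1 - \<delta>) powr (1 / real m)"
  have r: "0 < r" "r < 1"
    using \<delta> m_pos powr_less_mono2[of "1 / real m" "1 - \<delta>" 1] by (auto simp: r_def)
  have rate: "(1 - \<delta>) ^ (n div m) \<le> (1 / (1 - \<delta>)) * r ^ n" for n
  proof -
    have "real n = real (n div m) * real m + real (n mod m)"
      by (metis div_mult_mod_eq of_nat_add of_nat_mult)
    moreover have "real (n mod m) \<le> real m" using m_pos by simp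
    ultimately have "real n / real m \<le> real (n div m) + 1"
      using m_pos by (simp add: field_simps)
    then have "(1 - \<delta>) powr (real (n div m) + 1) \<le> (1 - \<delta>) powr (real n / real m)"
      using \<delta> by (intro powr_mono') auto
    also have "\<dots> = r ^ n"
      using \<delta> by (simp add: r_def powr_powr powr_realpow[symmetric] del: powr_realpow)
    finally show ?thesis
      using \<delta> by (simp add: powr_add powr_realpow field_simps)
  qed
  have close: "\<bar>mat_pow S P (k + n) a b - mat_pow S P n a' b\<bar> \<le> (1 / (1 - \<delta>)) * r ^ n"
    if "a \<in> S" "a' \<in> S" "b \<in> S" for a a' b n k
  proof -
    obtain l where l: "\<forall>a\<in>S. l \<le> mat_pow S P n a b \<and> mat_pow S P n a b \<le> l + (1 - \<delta>) ^ (n div m)"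
      using osc[OF \<open>b \<in> S\<close>] by blast
    have "l \<le> mat_pow S P (k + n) a b" "mat_pow S P (k + n) a b \<le> l + (1 - \<delta>) ^ (n div m)"
      using l average_bounds[OF that(1), of l "\<lambda>c. mat_pow S P n c b" "l + (1 - \<delta>) ^ (n div m)" k] that
      by (auto simp: mat_pow_add[OF finite_states] mat_mult_def)
    then show ?thesis using l[rule_format, OF that(2)] rate[of n] by linarith
  qed
  have r0: "(\<lambda>n. (1 / (1 - \<delta>)) * r ^ n) \<longlonglongrightarrow> 0"
    using r by (intro tendsto_mult_right_zero LIMSEQ_power_zero) auto
  have "Cauchy (\<lambda>n. mat_pow S P n b\<^sub>0 b)" if b: "b \<in> S" for b
  proof (rule metric_CauchyI)
    fix e :: real assume "0 < e"
    then obtain K where K: "(1 / (1 - \<delta>)) * r ^ K < e / 2"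
      using order_tendstoD(2)[OF r0, of "e / 2"] by (auto simp: eventually_sequentially)
    show "\<exists>K. \<forall>i\<ge>K. \<forall>j\<ge>K. dist (mat_pow S P i b\<^sub>0 b) (mat_pow S P j b\<^sub>0 b) < e"
    proof (intro exI[of _ K] allI impI)
      fix i j assume "K \<le> i" "K \<le> j"
      then have "\<bar>mat_pow S P i b\<^sub>0 b - mat_pow S P K b\<^sub>0 b\<bar> \<le> (1 / (1 - \<delta>)) * r ^ K"
        "\<bar>mat_pow S P j b\<^sub>0 b - mat_pow S P K b\<^sub>0 b\<bar> \<le> (1 / (1 - \<delta>)) * r ^ K"
        using close[of b\<^sub>0 b\<^sub>0 b "i - K" K] close[of b\<^sub>0 b\<^sub>0 b "j - K" K] b b\<^sub>0 by simp_all
      then show "dist (mat_pow S P i b\<^sub>0 b) (mat_pow S P j b\<^sub>0 b) < e"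
        using K unfolding dist_real_def by linarith
    qed
  qed
  then have "\<exists>l. (\<lambda>n. mat_pow S P n b\<^sub>0 b) \<longlonglongrightarrow> l" if "b \<in> S" for b
    using that Cauchy_convergent by (auto simp: convergent_def)
  then obtain \<pi>\<^sub>0 where \<pi>\<^sub>0: "\<And>b. b \<in> S \<Longrightarrow> (\<lambda>n. mat_pow S P n b\<^sub>0 b) \<longlonglongrightarrow> \<pi>\<^sub>0 b"
    by metis
  \<comment> \<open>The value 0 outside \<open>S\<close> meets the normalisation in
    \<open>stationary_distribution\<close>.\<close>
  define \<pi> where "\<pi> = (\<lambda>b. if b \<in> S then \<pi>\<^sub>0 b else 0)"
  have lim: "(\<lambda>n. mat_pow S P n b\<^sub>0 b) \<longlonglongrightarrow> \<pi> b" if "b \<in> S" for b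
    using \<pi>\<^sub>0[OF that] that by (simp add: \<pi>_def)
  have bound: "\<bar>mat_pow S P n a b - \<pi> b\<bar> \<le> (1 / (1 - \<delta>)) * r ^ n" if "a \<in> S" "b \<in> S" for a b n
  \<comment> \<open>Keep \<open>n\<close> fixed and let \<open>k\<close> tend to infinity in
    \<open>close\<close>.\<close>
  proof (rule LIMSEQ_le_const2)
    show "(\<lambda>k. \<bar>mat_pow S P n a b - mat_pow S P (k + n) b\<^sub>0 b\<bar>) \<longlonglongrightarrow> \<bar>mat_pow S P n a b - \<pi> b\<bar>"
      using lim[OF that(2)] by (intro tendsto_intros) (rule LIMSEQ_ignore_initial_segment)
    show "\<exists>K. \<forall>k\<ge>K. \<bar>mat_pow S P n a b - mat_pow S P (k + n) b\<^sub>0 b\<bar> \<le> (1 / (1 - \<delta>)) * r ^ n"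
      using close[OF b\<^sub>0 that, of _ n] by (auto simp: abs_minus_commute)
  qed
  have "stationary_distribution S P \<pi>"
    unfolding stationary_distribution_def vec_mat_def
  proof (intro conjI ballI allI impI)
    show "0 \<le> \<pi> a" if "a \<in> S" for a
      by (rule LIMSEQ_le_const[OF lim[OF that]]) (use that pow_nonneg in auto)
    have "(\<lambda>n. \<Sum>b\<in>S. mat_pow S P n b\<^sub>0 b) \<longlonglongrightarrow> (\<Sum>b\<in>S. \<pi> b)"
      by (intro tendsto_sum lim)
    then show "(\<Sum>b\<in>S. \<pi> b) = 1"
      using b\<^sub>0 by (simp add: pow_row_sum LIMSEQ_const_iff)
    show "(\<Sum>a\<in>S. \<pi> a * P a b) = \<pi> b" if "b \<in> S" for b
    proof (rule LIMSEQ_unique)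
      show "(\<lambda>n. mat_pow S P (Suc n) b\<^sub>0 b) \<longlonglongrightarrow> (\<Sum>a\<in>S. \<pi> a * P a b)"
        unfolding mat_pow.simps mat_mult_def by (intro tendsto_intros lim)
      show "(\<lambda>n. mat_pow S P (Suc n) b\<^sub>0 b) \<longlonglongrightarrow> \<pi> b"
        using lim[OF that] by (rule LIMSEQ_Suc)
    qed
  qed (simp add: \<pi>_def)
  then show thesis using r bound that by blast
qed

text \<open>Averaging the rows of \<open>P^n\<close> against any stationary \<open>\<pi>'\<close>
  returns \<open>\<pi>'\<close> for all \<open>n\<close>, while each row tends to
  \<open>\<pi>\<^sub>0\<close>. So the two agree, and the rate found for the constructed
  distribution holds for the given \<open>\<pi>\<close>.\<close>

lemma stationary_limit:
  assumes st: "stationary_distribution S P \<pi>"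
  obtains C r where "0 < r" "r < 1"
    "\<And>a b n. a \<in> S \<Longrightarrow> b \<in> S \<Longrightarrow> \<bar>mat_pow S P n a b - \<pi> b\<bar> \<le> C * r ^ n"
    and "\<And>\<pi>'. stationary_distribution S P \<pi>' \<Longrightarrow> \<pi>' = \<pi>"
proof -
  obtain \<pi>\<^sub>0 C r where \<pi>\<^sub>0: "stationary_distribution S P \<pi>\<^sub>0" and r: "0 < r" "r < 1"
    and bound: "\<And>a b n. a \<in> S \<Longrightarrow> b \<in> S \<Longrightarrow> \<bar>mat_pow S P n a b - \<pi>\<^sub>0 b\<bar> \<le> C * r ^ n"
    by (rule geometric_ergodicity) blast
  have unique: "\<pi>' = \<pi>\<^sub>0" if st': "stationary_distribution S P \<pi>'" for \<pi>'
  proof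
    fix b
    show "\<pi>' b = \<pi>\<^sub>0 b"
    proof (cases "b \<in> S")
      case True
      have lim: "(\<lambda>n. mat_pow S P n a b) \<longlonglongrightarrow> \<pi>\<^sub>0 b" if "a \<in> S" for a
      proof (rule LIMSEQ_I)
        fix e :: real assume "0 < e"
        have "(\<lambda>n. C * r ^ n) \<longlonglongrightarrow> 0"
          using r by (auto intro!: tendsto_mult_right_zero LIMSEQ_power_zero)
        then obtain K where "\<forall>n\<ge>K. C * r ^ n < e"
          using order_tendstoD(2)[of _ 0 _ e] \<open>0 < e\<close> by (fastforce simp: eventually_sequentially)
        then show "\<exists>K. \<forall>n\<ge>K. norm (mat_pow S P n a b - \<pi>\<^sub>0 b) < e"
          using bound[OF that True] by (metis order_le_less_trans real_norm_def)
      qed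
      have "(\<lambda>n. \<Sum>a\<in>S. \<pi>' a * mat_pow S P n a b) \<longlonglongrightarrow> (\<Sum>a\<in>S. \<pi>' a * \<pi>\<^sub>0 b)"
        by (intro tendsto_intros lim)
      then show ?thesis
        using st' True
        by (simp add: stationary_pow LIMSEQ_const_iff sum_distrib_right[symmetric] stationary_distribution_def)
    next
      case False
      then show ?thesis using st' \<pi>\<^sub>0 by (simp add: stationary_distribution_def)
    qed
  qed
  show thesis
    using that[OF r] bound unique unique[OF st] by blast
qed

lemma ex1_stationary: "\<exists>!\<pi>. stationary_distribution S P \<pi>"
  by (metis geometric_ergodicity stationary_limit)

text \<open>The inverse is the Neumann series \<open>I + \<Sum>\<^sub>n\<^sub>\<ge>\<^sub>1 (P - 1 \<pi>)\<^sup>n\<close>, using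
  \<open>(P - 1 \<pi>)\<^sup>n = P\<^sup>n - 1 \<pi>\<close> for \<open>n \<ge> 1\<close>.\<close>

lemma invertible_fundamental_base:
  assumes st: "stationary_distribution S P \<pi>"
  shows "mat_invertible S (fundamental_base P \<pi>)"
proof -
  obtain C r where r: "0 < r" "r < 1"
    and bound: "\<And>a b n. a \<in> S \<Longrightarrow> b \<in> S \<Longrightarrow> \<bar>mat_pow S P n a b - \<pi> b\<bar> \<le> C * r ^ n"
    by (rule stationary_limit[OF st]) blast
  \<comment> \<open>\<open>E 0\<close> is \<open>I - 1 \<pi>\<close>, not \<open>I\<close>; this is
    why the inverse below is \<open>\<pi> b + Q a b\<close> with \<open>Q\<close> summed from index
    0.\<close>
  define E where "E = (\<lambda>n a b. mat_pow S P n a b - \<pi> b)"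
  define Q where "Q = (\<lambda>a b. \<Sum>n. E n a b)"
  have "summable (\<lambda>n. E n a b)" if "a \<in> S" "b \<in> S" for a b
    by (rule summable_comparison_test'[where N = 0 and g = "\<lambda>n. C * r ^ n"])
      (use r bound[OF that] in \<open>auto simp: E_def intro!: summable_mult summable_geometric\<close>)
  then have Q: "(\<lambda>n. E n a b) sums Q a b" if "a \<in> S" "b \<in> S" for a b
    using that by (simp add: Q_def summable_sums)
  have E_lim: "(\<lambda>n. E n a b) \<longlonglongrightarrow> 0" if "a \<in> S" "b \<in> S" for a b
    using Q[OF that] by (intro summable_LIMSEQ_zero) (auto simp: sums_iff)
  have telescope: "(\<lambda>n. E n a b - E (Suc n) a b) sums (mat_one a b - \<pi> b)" if "a \<in> S" "b \<in> S" for a b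
    using telescope_sums'[OF E_lim[OF that]] by (simp add: E_def)
  have sum_pi: "(\<Sum>a\<in>S. \<pi> a) = 1" and pi_P: "\<And>b. b \<in> S \<Longrightarrow> (\<Sum>a\<in>S. \<pi> a * P a b) = \<pi> b"
    using st by (auto simp: stationary_distribution_def vec_mat_def)
  have one_l: "(\<Sum>b\<in>S. mat_one a b * F b) = F a" if "a \<in> S" for a F
    using mat_mult_one_left[OF finite_states that, of "\<lambda>b _. F b"] by (simp add: mat_mult_def)
  have one_r: "(\<Sum>a\<in>S. F a * mat_one a b) = F b" if "b \<in> S" for b F
    using mat_mult_one_right[OF finite_states that, of "\<lambda>_. F"] by (simp add: mat_mult_def)
  have PE: "(\<Sum>c\<in>S. P a c * E n c b) = E (Suc n) a b" if "a \<in> S" "b \<in> S" for a b n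
    using that mat_pow_Suc_left[OF finite_states that, of P n] row_sum[OF that(1)]
    by (simp add: E_def right_diff_distrib sum_subtractf sum_distrib_right[symmetric])
  have EP: "(\<Sum>c\<in>S. E n a c * P c b) = E (Suc n) a b" if "a \<in> S" "b \<in> S" for a b n
    using that pi_P by (simp add: E_def left_diff_distrib sum_subtractf mat_mult_def)
  have piE: "(\<Sum>c\<in>S. \<pi> c * E n c b) = 0" if "b \<in> S" for b n
    using stationary_pow[OF st that, of n] sum_pi
    by (simp add: E_def right_diff_distrib sum_subtractf sum_distrib_right[symmetric])
  have E1: "(\<Sum>c\<in>S. E n a c) = 0" if "a \<in> S" for a n
    using pow_row_sum[OF that, of n] sum_pi by (simp add: E_def sum_subtractf)
  have "is_mat_inverse S (fundamental_base P \<pi>) (\<lambda>a b. \<pi> b + Q a b)"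
    unfolding is_mat_inverse_def
  proof (intro ballI conjI)
    fix a b assume ab: "a \<in> S" "b \<in> S"
    have "(\<lambda>n. \<Sum>c\<in>S. fundamental_base P \<pi> a c * E n c b) sums (\<Sum>c\<in>S. fundamental_base P \<pi> a c * Q c b)"
      using ab by (intro sums_sum sums_mult Q)
    \<comment> \<open>Because \<open>\<pi>\<close> annihilates \<open>E n\<close>, the base acts on
      it as \<open>I - P\<close>, so the series telescopes to \<open>E 0\<close>. The other side
      uses that the rows of \<open>E n\<close> sum to 0.\<close>
    moreover have "(\<Sum>c\<in>S. fundamental_base P \<pi> a c * E n c b) = E n a b - E (Suc n) a b" for n
      using one_l[OF ab(1), of "\<lambda>c. E n c b"] PE[OF ab, of n] piE[OF ab(2), of n]
      by (simp add: fundamental_base_def algebra_simps sum.distrib sum_subtractf)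
    ultimately have "(\<Sum>c\<in>S. fundamental_base P \<pi> a c * Q c b) = mat_one a b - \<pi> b"
      using telescope[OF ab] by (simp add: sums_unique2)
    moreover have "(\<Sum>c\<in>S. fundamental_base P \<pi> a c) = 1"
      using one_l[OF ab(1), of "\<lambda>_. 1"] row_sum[OF ab(1)] sum_pi
      by (simp add: fundamental_base_def sum.distrib sum_subtractf)
    ultimately show "mat_mult S (fundamental_base P \<pi>) (\<lambda>a b. \<pi> b + Q a b) a b = mat_one a b"
      by (simp add: mat_mult_def distrib_left sum.distrib sum_distrib_right[symmetric])
    have "(\<lambda>n. \<Sum>c\<in>S. E n a c * fundamental_base P \<pi> c b) sums (\<Sum>c\<in>S. Q a c * fundamental_base P \<pi> c b)"
      using ab by (intro sums_sum sums_mult2 Q)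
    moreover have "(\<Sum>c\<in>S. E n a c * fundamental_base P \<pi> c b) = E n a b - E (Suc n) a b" for n
      using one_r[OF ab(2), of "\<lambda>c. E n a c"] EP[OF ab, of n] E1[OF ab(1), of n]
      by (simp add: fundamental_base_def distrib_left right_diff_distrib sum.distrib sum_subtractf
          sum_distrib_right[symmetric])
    ultimately have "(\<Sum>c\<in>S. Q a c * fundamental_base P \<pi> c b) = mat_one a b - \<pi> b"
      using telescope[OF ab] by (simp add: sums_unique2)
    moreover have "(\<Sum>c\<in>S. \<pi> c * fundamental_base P \<pi> c b) = \<pi> b"
      using one_r[OF ab(2), of \<pi>] pi_P[OF ab(2)] sum_pi
      by (simp add: fundamental_base_def distrib_left right_diff_distrib sum.distrib sum_subtractf
          sum_distrib_right[symmetric])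
    ultimately show "mat_mult S (\<lambda>a b. \<pi> b + Q a b) (fundamental_base P \<pi>) a b = mat_one a b"
      by (simp add: mat_mult_def distrib_right sum.distrib)
  qed
  then show ?thesis by (auto simp: mat_invertible_def)
qed

end

section \<open>Expectations along a Markov chain\<close>

locale markov_process = stochastic_matrix S P for S :: "'a set" and P +
  fixes \<Omega> :: "'w measure" and X :: "nat \<Rightarrow> 'w \<Rightarrow> 'a"
  assumes chain: "markov_chain \<Omega> S P X"
begin

sublocale prob_space \<Omega>
  using chain by (simp add: markov_chain_def)

lemma X_measurable [measurable]: "X n \<in> measurable \<Omega> (count_space S)"
  using chain by (simp add: markov_chain_def)

lemma X_in: "\<omega> \<in> space \<Omega> \<Longrightarrow> X n \<omega> \<in> S"
  using measurable_space[OF X_measurable] by simp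

definition cylinder :: "nat \<Rightarrow> (nat \<Rightarrow> 'a) \<Rightarrow> 'w set" where
  "cylinder n \<tau> = {\<omega> \<in> space \<Omega>. \<forall>i\<le>n. X i \<omega> = \<tau> i}"

lemma X_eq_sets: "{\<omega> \<in> space \<Omega>. X n \<omega> = b} \<in> events"
proof (cases "b \<in> S")
  case True
  then have "{b} \<in> sets (count_space S)" by simp
  from measurable_sets[OF X_measurable this, of n] show ?thesis
    by (simp add: vimage_def Int_def conj_commute)
next
  case False
  then have "{\<omega> \<in> space \<Omega>. X n \<omega> = b} = {}" using X_in by auto
  then show ?thesis by simp
qed

lemma cylinder_sets: "cylinder n \<tau> \<in> events"
proof -
  have "cylinder n \<tau> = (\<Inter>i\<in>{..n}. {\<omega> \<in> space \<Omega>. X i \<omega> = \<tau> i})"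
    by (auto simp: cylinder_def)
  then show ?thesis
    using X_eq_sets by (auto intro!: sets.finite_INT)
qed

text \<open>The Markov property is given only on cylinders of positive probability. In product form
  it also covers null cylinders, where both sides vanish.\<close>

lemma prob_cylinder_step:
  assumes "\<And>i. i \<le> n \<Longrightarrow> \<tau> i \<in> S" "b \<in> S"
  shows "prob (cylinder n \<tau> \<inter> {\<omega> \<in> space \<Omega>. X (Suc n) \<omega> = b}) = prob (cylinder n \<tau>) * P (\<tau> n) b"
proof (cases "prob (cylinder n \<tau>) = 0")
  case True
  have "prob (cylinder n \<tau> \<inter> {\<omega> \<in> space \<Omega>. X (Suc n) \<omega> = b}) \<le> prob (cylinder n \<tau>)"
    using cylinder_sets by (intro finite_measure_mono) auto
  then show ?thesis using True measure_nonneg[of \<Omega>] by (simp add: order_antisym)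
next
  case False
  then have pos: "prob (cylinder n \<tau>) > 0" using zero_less_measure_iff by blast
  \<comment> \<open>The definition of \<open>markov_chain\<close> speaks of one sequence, so the
    past and the next state are merged into one.\<close>
  define a where "a = \<tau>(Suc n := b)"
  have eq: "{\<omega> \<in> space \<Omega>. \<forall>i\<le>n. X i \<omega> = a i} = cylinder n \<tau>"
    by (auto simp: cylinder_def a_def)
  have "{\<omega> \<in> space \<Omega>. X (Suc n) \<omega> = a (Suc n) \<and> (\<forall>i\<le>n. X i \<omega> = a i)}
      = cylinder n \<tau> \<inter> {\<omega> \<in> space \<Omega>. X (Suc n) \<omega> = b}"
    by (auto simp: cylinder_def a_def)
  moreover have "\<forall>i\<le>Suc n. a i \<in> S" using assms by (auto simp: a_def le_Suc_eq)
  ultimately have "prob (cylinder n \<tau> \<inter> {\<omega> \<in> space \<Omega>. X (Suc n) \<omega> = b}) / prob (cylinder n \<tau>)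
      = P (a n) (a (Suc n))"
    using chain[unfolded markov_chain_def cond_prob_def, THEN conjunct2, THEN conjunct2, rule_format, of n a] pos
    by (simp add: eq)
  then show ?thesis using pos by (simp add: a_def field_simps)
qed

text \<open>Functions of the chain up to time \<open>n\<close> are encoded as functions of the whole path that only
  look at the first \<open>n + 1\<close> coordinates.\<close>

definition adapted :: "nat \<Rightarrow> ((nat \<Rightarrow> 'a) \<Rightarrow> 'c) \<Rightarrow> bool" where
  "adapted n F \<longleftrightarrow> (\<forall>x y. (\<forall>i\<le>n. x i = y i) \<longrightarrow> F x = F y)"

text \<open>With finitely many states there are finitely many paths up to time \<open>n\<close>, and
  each sample point lies in exactly one of their cylinders. Adapted functions are therefore simple
  functions, which makes them integrable with values in any Banach space.\<close>

lemma cylinder_decomposition: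
  fixes F :: "(nat \<Rightarrow> 'a) \<Rightarrow> 'c::real_vector"
  assumes "adapted n F" "\<omega> \<in> space \<Omega>"
  shows "F (\<lambda>i. X i \<omega>) = (\<Sum>\<tau>\<in>{..n} \<rightarrow>\<^sub>E S. indicator (cylinder n \<tau>) \<omega> *\<^sub>R F \<tau>)"
proof -
  \<comment> \<open>The restriction makes the observed path extensional, so that it is exactly one
    of the summation indices.\<close>
  define \<tau>\<^sub>0 where "\<tau>\<^sub>0 = restrict (\<lambda>i. X i \<omega>) {..n}"
  have mem: "\<tau>\<^sub>0 \<in> {..n} \<rightarrow>\<^sub>E S" using X_in[OF assms(2)] by (auto simp: \<tau>\<^sub>0_def)
  have "\<omega> \<in> cylinder n \<tau> \<longleftrightarrow> \<tau> = \<tau>\<^sub>0" if "\<tau> \<in> {..n} \<rightarrow>\<^sub>E S" for \<tau>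
  proof
    show "\<tau> = \<tau>\<^sub>0" if "\<omega> \<in> cylinder n \<tau>"
      by (rule PiE_ext[OF \<open>\<tau> \<in> {..n} \<rightarrow>\<^sub>E S\<close> mem]) (use that in \<open>simp add: cylinder_def \<tau>\<^sub>0_def\<close>)
    show "\<omega> \<in> cylinder n \<tau>" if "\<tau> = \<tau>\<^sub>0"
      using that assms(2) by (simp add: cylinder_def \<tau>\<^sub>0_def)
  qed
  then have "(\<Sum>\<tau>\<in>{..n} \<rightarrow>\<^sub>E S. indicator (cylinder n \<tau>) \<omega> *\<^sub>R F \<tau>) = (\<Sum>\<tau>\<in>{..n} \<rightarrow>\<^sub>E S. if \<tau> = \<tau>\<^sub>0 then F \<tau> else 0)"
    by (intro sum.cong) (auto simp: indicator_def)
  also have "\<dots> = F \<tau>\<^sub>0"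
    using mem finite_states by (simp add: finite_PiE)
  also have "\<dots> = F (\<lambda>i. X i \<omega>)"
    using assms(1) by (auto simp: adapted_def \<tau>\<^sub>0_def)
  finally show ?thesis by simp
qed

lemma has_bochner_integral_adapted:
  fixes F :: "(nat \<Rightarrow> 'a) \<Rightarrow> 'c::{banach, second_countable_topology}"
  assumes "adapted n F"
  shows "has_bochner_integral \<Omega> (\<lambda>\<omega>. F (\<lambda>i. X i \<omega>))
    (\<Sum>\<tau>\<in>{..n} \<rightarrow>\<^sub>E S. prob (cylinder n \<tau>) *\<^sub>R F \<tau>)"
proof -
  have "has_bochner_integral \<Omega> (\<lambda>\<omega>. \<Sum>\<tau>\<in>{..n} \<rightarrow>\<^sub>E S. indicator (cylinder n \<tau>) \<omega> *\<^sub>R F \<tau>)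
    (\<Sum>\<tau>\<in>{..n} \<rightarrow>\<^sub>E S. prob (cylinder n \<tau>) *\<^sub>R F \<tau>)"
    by (intro has_bochner_integral_sum has_bochner_integral_indicator cylinder_sets)
      (simp add: emeasure_eq_measure)
  then show ?thesis
    by (subst has_bochner_integral_cong[OF refl cylinder_decomposition[OF assms] refl])
qed

lemma integrable_adapted:
  fixes F :: "(nat \<Rightarrow> 'a) \<Rightarrow> 'c::{banach, second_countable_topology}"
  shows "adapted n F \<Longrightarrow> integrable \<Omega> (\<lambda>\<omega>. F (\<lambda>i. X i \<omega>))"
  using has_bochner_integral_adapted integrable.intros by blast

text \<open>This takes the place of conditional expectations: the last step is integrated out
  against the transition row. It follows by splitting into cylinders and next states and applying
  \<open>prob_cylinder_step\<close>. The general target type serves real moments and complex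
  characteristic functions alike.\<close>

lemma markov_expectation:
  fixes H :: "(nat \<Rightarrow> 'a) \<Rightarrow> 'a \<Rightarrow> 'c::{banach, second_countable_topology}"
  assumes H: "\<And>b. adapted n (\<lambda>x. H x b)"
  shows "(LINT \<omega>|\<Omega>. H (\<lambda>i. X i \<omega>) (X (Suc n) \<omega>))
    = (LINT \<omega>|\<Omega>. (\<Sum>b\<in>S. P (X n \<omega>) b *\<^sub>R H (\<lambda>i. X i \<omega>) b))"
proof -
  let ?B = "\<lambda>b. {\<omega> \<in> space \<Omega>. X (Suc n) \<omega> = b}"
  have split: "H (\<lambda>i. X i \<omega>) (X (Suc n) \<omega>)
      = (\<Sum>\<tau>\<in>{..n} \<rightarrow>\<^sub>E S. \<Sum>b\<in>S. indicator (cylinder n \<tau> \<inter> ?B b) \<omega> *\<^sub>R H \<tau> b)"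
    if \<omega>: "\<omega> \<in> space \<Omega>" for \<omega>
  proof -
    have "(\<Sum>b\<in>S. indicator (?B b) \<omega> *\<^sub>R H \<tau> b) = (\<Sum>b\<in>S. if b = X (Suc n) \<omega> then H \<tau> b else 0)" for \<tau>
      using \<omega> by (intro sum.cong) (auto simp: indicator_def)
    then have "H \<tau> (X (Suc n) \<omega>) = (\<Sum>b\<in>S. indicator (?B b) \<omega> *\<^sub>R H \<tau> b)" for \<tau>
      using X_in[OF \<omega>] finite_states by simp
    then show ?thesis
      using cylinder_decomposition[OF H \<omega>, of "X (Suc n) \<omega>"]
      by (simp add: scaleR_sum_right indicator_inter_arith)
  qed
  have "has_bochner_integral \<Omega>
      (\<lambda>\<omega>. \<Sum>\<tau>\<in>{..n} \<rightarrow>\<^sub>E S. \<Sum>b\<in>S. indicator (cylinder n \<tau> \<inter> ?B b) \<omega> *\<^sub>R H \<tau> b)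
      (\<Sum>\<tau>\<in>{..n} \<rightarrow>\<^sub>E S. \<Sum>b\<in>S. prob (cylinder n \<tau> \<inter> ?B b) *\<^sub>R H \<tau> b)"
    using cylinder_sets X_eq_sets
    by (intro has_bochner_integral_sum has_bochner_integral_indicator)
      (auto simp: emeasure_eq_measure)
  then have "has_bochner_integral \<Omega> (\<lambda>\<omega>. H (\<lambda>i. X i \<omega>) (X (Suc n) \<omega>))
      (\<Sum>\<tau>\<in>{..n} \<rightarrow>\<^sub>E S. \<Sum>b\<in>S. prob (cylinder n \<tau> \<inter> ?B b) *\<^sub>R H \<tau> b)"
    by (subst has_bochner_integral_cong[OF refl split refl])
  moreover have "adapted n (\<lambda>x. \<Sum>b\<in>S. P (x n) b *\<^sub>R H x b)"
    unfolding adapted_def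
  proof (intro allI impI sum.cong refl)
    fix x y :: "nat \<Rightarrow> 'a" and b
    assume "\<forall>i\<le>n. x i = y i"
    then show "P (x n) b *\<^sub>R H x b = P (y n) b *\<^sub>R H y b"
      using H[of b] by (simp add: adapted_def)
  qed
  note has_bochner_integral_adapted[OF this]
  moreover have "(\<Sum>\<tau>\<in>{..n} \<rightarrow>\<^sub>E S. \<Sum>b\<in>S. prob (cylinder n \<tau> \<inter> ?B b) *\<^sub>R H \<tau> b)
      = (\<Sum>\<tau>\<in>{..n} \<rightarrow>\<^sub>E S. prob (cylinder n \<tau>) *\<^sub>R (\<Sum>b\<in>S. P (\<tau> n) b *\<^sub>R H \<tau> b))"
    unfolding scaleR_sum_right
    by (intro sum.cong refl) (subst prob_cylinder_step, auto simp: PiE_iff)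
  ultimately show ?thesis
    by (simp add: has_bochner_integral_integral_eq)
qed

end

section \<open>Martingales driven by a Markov chain\<close>

locale markov_martingale = markov_process S P \<Omega> X
  for S :: "'a set" and P and \<Omega> :: "'w measure" and X +
  fixes D :: "'a \<Rightarrow> 'a \<Rightarrow> real" and C :: real
  assumes mean_zero: "\<And>a. a \<in> S \<Longrightarrow> (\<Sum>b\<in>S. P a b * D a b) = 0"
    and D_bound: "\<And>a b. a \<in> S \<Longrightarrow> b \<in> S \<Longrightarrow> \<bar>D a b\<bar> \<le> C"
begin

text \<open>A function of paths rather than of sample points, so that \<open>adapted\<close> can
  express which coordinates it sees.\<close>

definition mart :: "nat \<Rightarrow> (nat \<Rightarrow> 'a) \<Rightarrow> real" where
  "mart n x = (\<Sum>k<n. D (x k) (x (Suc k)))"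

abbreviation M :: "nat \<Rightarrow> 'w \<Rightarrow> real" where
  "M n \<omega> \<equiv> mart n (\<lambda>i. X i \<omega>)"

lemma mart_0 [simp]: "mart 0 x = 0"
  by (simp add: mart_def)

lemma mart_Suc: "mart (Suc n) x = mart n x + D (x n) (x (Suc n))"
  by (simp add: mart_def)

lemma mart_cong: "(\<And>i. i \<le> n \<Longrightarrow> x i = y i) \<Longrightarrow> mart n x = mart n y"
  by (auto simp: mart_def intro!: sum.cong)

lemma adapted_mart: "adapted n (\<lambda>x. F (mart n x) (x n))"
  unfolding adapted_def by (metis mart_cong order_refl)

lemma integrable_mart:
  fixes F :: "real \<Rightarrow> 'a \<Rightarrow> 'c::{banach, second_countable_topology}"
  shows "integrable \<Omega> (\<lambda>\<omega>. F (M n \<omega>) (X n \<omega>))"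
  by (rule integrable_adapted[OF adapted_mart])

lemma expectation_mart_Suc:
  fixes F :: "real \<Rightarrow> 'a \<Rightarrow> 'c::{banach, second_countable_topology}"
  shows "(LINT \<omega>|\<Omega>. F (M (Suc n) \<omega>) (X (Suc n) \<omega>))
    = (LINT \<omega>|\<Omega>. (\<Sum>b\<in>S. P (X n \<omega>) b *\<^sub>R F (M n \<omega> + D (X n \<omega>) b) b))"
  unfolding mart_Suc
  by (rule markov_expectation[where H = "\<lambda>x b. F (mart n x + D (x n) b) b"])
    (rule adapted_mart[where F = "\<lambda>u v. F (u + D v b) b" for b])

text \<open>Reduces a moment recursion to a bound for one step from a fixed state \<open>a\<close>
  and a fixed current value \<open>u\<close>.\<close>

lemma expectation_mart_mono:
  fixes F G :: "real \<Rightarrow> real"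
  assumes "\<And>a u. a \<in> S \<Longrightarrow> (\<Sum>b\<in>S. P a b * F (u + D a b)) \<le> G u"
  shows "(LINT \<omega>|\<Omega>. F (M (Suc n) \<omega>)) \<le> (LINT \<omega>|\<Omega>. G (M n \<omega>))"
proof -
  have "(LINT \<omega>|\<Omega>. F (M (Suc n) \<omega>)) = (LINT \<omega>|\<Omega>. (\<Sum>b\<in>S. P (X n \<omega>) b * F (M n \<omega> + D (X n \<omega>) b)))"
    using expectation_mart_Suc[of "\<lambda>u _. F u"] by simp
  also have "\<dots> \<le> (LINT \<omega>|\<Omega>. G (M n \<omega>))"
    using assms X_in
    by (intro integral_mono integrable_mart[where F = "\<lambda>u _. G u"]
        integrable_mart[where F = "\<lambda>u a. \<Sum>b\<in>S. P a b * F (u + D a b)"]) auto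
  finally show ?thesis .
qed

lemma C_nonneg: "0 \<le> C"
proof -
  obtain \<omega> where "\<omega> \<in> space \<Omega>" using not_empty by blast
  then show ?thesis using D_bound[OF X_in X_in, of \<omega> \<omega> 0 0] by linarith
qed

text \<open>A multiple of \<open>D\<close> averages to 0, so pointwise bounds need to hold only up
  to such a term.\<close>

lemma average_le:
  assumes "a \<in> S" "\<And>b. b \<in> S \<Longrightarrow> f b \<le> c + e * D a b"
  shows "(\<Sum>b\<in>S. P a b * f b) \<le> c"
proof -
  have "(\<Sum>b\<in>S. P a b * f b) \<le> (\<Sum>b\<in>S. P a b * (c + e * D a b))"
    using assms nonneg by (intro sum_mono mult_left_mono) auto
  also have "\<dots> = c * (\<Sum>b\<in>S. P a b) + e * (\<Sum>b\<in>S. P a b * D a b)"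
    by (simp add: distrib_left sum.distrib sum_distrib_left algebra_simps)
  finally show ?thesis using assms(1) by (simp add: row_sum mean_zero)
qed

lemma D_power_bound: "a \<in> S \<Longrightarrow> b \<in> S \<Longrightarrow> even k \<Longrightarrow> D a b ^ k \<le> C ^ k"
  using power_mono[OF D_bound, of a b k] by (simp add: power_even_abs)

section \<open>Moment bounds and the strong law\<close>

lemma second_moment: "(LINT \<omega>|\<Omega>. (M n \<omega>)\<^sup>2) \<le> C\<^sup>2 * real n"
proof (induction n)
  case (Suc n)
  have "(LINT \<omega>|\<Omega>. (M (Suc n) \<omega>)\<^sup>2) \<le> (LINT \<omega>|\<Omega>. (M n \<omega>)\<^sup>2 + C\<^sup>2)"
  proof (rule expectation_mart_mono)
    fix a u assume a: "a \<in> S"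
    show "(\<Sum>b\<in>S. P a b * (u + D a b)\<^sup>2) \<le> u\<^sup>2 + C\<^sup>2"
      using D_power_bound[OF a, of _ 2]
      by (intro average_le[OF a, where e = "2 * u"]) (simp add: power2_sum)
  qed
  also have "\<dots> = (LINT \<omega>|\<Omega>. (M n \<omega>)\<^sup>2) + C\<^sup>2"
    using integrable_mart[of "\<lambda>u _. u\<^sup>2" n] by (simp add: prob_space)
  finally show ?case using Suc by (simp add: algebra_simps)
qed simp

text \<open>One step adds at most a multiple of the second moment, which is linear in
  \<open>n\<close>, plus a constant; summing gives quadratic growth.\<close>

lemma fourth_moment: "(LINT \<omega>|\<Omega>. (M n \<omega>) ^ 4) \<le> 8 * C ^ 4 * (real n)\<^sup>2"
proof (induction n)
  case (Suc n)
  have "(LINT \<omega>|\<Omega>. (M (Suc n) \<omega>) ^ 4) \<le> (LINT \<omega>|\<Omega>. (M n \<omega>) ^ 4 + 8 * C\<^sup>2 * (M n \<omega>)\<^sup>2 + 3 * C ^ 4)"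
  proof (rule expectation_mart_mono)
    fix a u assume a: "a \<in> S"
    show "(\<Sum>b\<in>S. P a b * (u + D a b) ^ 4) \<le> u ^ 4 + 8 * C\<^sup>2 * u\<^sup>2 + 3 * C ^ 4"
    proof (rule average_le[OF a, where e = "4 * u ^ 3"])
      fix b assume b: "b \<in> S"
      let ?d = "D a b"
      \<comment> \<open>The added square cancels the term \<open>4 * u * ?d ^ 3\<close>, which has
        no sign and does not average to 0; its price is raising the coefficients 6 and 1 to 8 and
        3.\<close>
      have "(u + ?d) ^ 4 + 2 * (?d * (u - ?d))\<^sup>2 = u ^ 4 + 4 * u ^ 3 * ?d + 8 * ?d\<^sup>2 * u\<^sup>2 + 3 * ?d ^ 4"
        by algebra
      moreover have "?d\<^sup>2 * u\<^sup>2 \<le> C\<^sup>2 * u\<^sup>2" "?d ^ 4 \<le> C ^ 4"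
        using D_power_bound[OF a b] by (auto intro!: mult_right_mono)
      moreover have "0 \<le> (?d * (u - ?d))\<^sup>2" by simp
      ultimately show "(u + ?d) ^ 4 \<le> u ^ 4 + 8 * C\<^sup>2 * u\<^sup>2 + 3 * C ^ 4 + 4 * u ^ 3 * ?d"
        by linarith
    qed
  qed
  also have "\<dots> = (LINT \<omega>|\<Omega>. (M n \<omega>) ^ 4) + 8 * C\<^sup>2 * (LINT \<omega>|\<Omega>. (M n \<omega>)\<^sup>2) + 3 * C ^ 4"
    using integrable_mart[of "\<lambda>u _. u\<^sup>2" n] integrable_mart[of "\<lambda>u _. u ^ 4" n]
    by (simp add: prob_space)
  also have "\<dots> \<le> 8 * C ^ 4 * (real n)\<^sup>2 + 8 * C\<^sup>2 * (C\<^sup>2 * real n) + 3 * C ^ 4"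
    using Suc second_moment by (intro add_mono mult_left_mono) auto
  also have "\<dots> \<le> 8 * C ^ 4 * (real (Suc n))\<^sup>2"
  proof -
    have "8 * C ^ 4 * (real (Suc n))\<^sup>2 - (8 * C ^ 4 * (real n)\<^sup>2 + 8 * C\<^sup>2 * (C\<^sup>2 * real n) + 3 * C ^ 4)
        = C ^ 4 * (8 * real n + 5)"
      by (simp add: power2_eq_square power4_eq_xxxx algebra_simps)
    also have "\<dots> \<ge> 0" by simp
    finally show ?thesis by simp
  qed
  finally show ?case .
qed simp

lemma M_measurable [measurable]: "M n \<in> borel_measurable \<Omega>"
  using integrable_mart[of "\<lambda>u _. u" n] by simp

text \<open>The fourth moments of \<open>M n / n\<close> are of order \<open>1 / n^2\<close>, hence
  summable. So the series of \<open>(M n / n) ^ 4\<close> has finite expectation, converges almost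
  surely, and its terms tend to 0.\<close>

lemma strong_law: "AE \<omega> in \<Omega>. (\<lambda>n. M n \<omega> / real n) \<longlonglongrightarrow> 0"
proof -
  define Y where "Y = (\<lambda>n \<omega>. (M n \<omega> / real n) ^ 4)"
  have [measurable]: "Y n \<in> borel_measurable \<Omega>" for n unfolding Y_def by measurable
  have Y0: "0 \<le> Y n \<omega>" for n \<omega> by (simp add: Y_def)
  have "(LINT \<omega>|\<Omega>. Y n \<omega>) \<le> 8 * C ^ 4 * inverse (real n ^ 2)" for n
  proof -
    have "(LINT \<omega>|\<Omega>. Y n \<omega>) = (LINT \<omega>|\<Omega>. (M n \<omega>) ^ 4) / real n ^ 4"
      by (simp add: Y_def power_divide)
    also have "\<dots> \<le> 8 * C ^ 4 * (real n)\<^sup>2 / real n ^ 4"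
      by (intro divide_right_mono fourth_moment) auto
    also have "\<dots> = 8 * C ^ 4 * inverse (real n ^ 2)"
      \<comment> \<open>At \<open>n = 0\<close> both sides are 0, since division by zero and
        \<open>inverse 0\<close> give 0.\<close>
      by (cases "n = 0") (auto simp: field_simps power2_eq_square power4_eq_xxxx)
    finally show ?thesis .
  qed
  then have "summable (\<lambda>n. LINT \<omega>|\<Omega>. Y n \<omega>)"
    using Y0 by (intro summable_comparison_test'[where N = 0, OF summable_mult[OF inverse_power_summable[of 2]]])
      (auto simp: Bochner_Integration.integral_nonneg)
  then have fin: "(\<Sum>n. ennreal (LINT \<omega>|\<Omega>. Y n \<omega>)) \<noteq> \<top>"
    using Y0 by (intro ennreal_suminf_neq_top) auto
  have int: "integrable \<Omega> (Y n)" for n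
    unfolding Y_def by (rule integrable_mart[where F = "\<lambda>u _. (u / real n) ^ 4"])
  have "(\<integral>\<^sup>+ \<omega>. (\<Sum>n. ennreal (Y n \<omega>)) \<partial>\<Omega>) = (\<Sum>n. ennreal (LINT \<omega>|\<Omega>. Y n \<omega>))"
    using Y0 int by (subst nn_integral_suminf) (auto simp: nn_integral_eq_integral)
  then have "AE \<omega> in \<Omega>. (\<Sum>n. ennreal (Y n \<omega>)) \<noteq> \<infinity>"
    using fin by (intro nn_integral_PInf_AE) auto
  then show ?thesis
  proof eventually_elim
    case (elim \<omega>)
    then have "summable (\<lambda>n. Y n \<omega>)"
      using Y0 by (intro summable_suminf_not_top) auto
    then have "(\<lambda>n. (M n \<omega> / real n) ^ 4) \<longlonglongrightarrow> 0"
      unfolding Y_def by (rule summable_LIMSEQ_zero)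
    then show ?case by (simp add: power_tendsto_0_iff)
  qed
qed

section \<open>Characteristic function of the martingale\<close>

text \<open>The corrector \<open>h\<close> replaces the conditional variance of a step by the constant \<open>\<sigma>2\<close>: up to
  \<open>O(\<bar>\<epsilon>\<bar>\<^sup>3)\<close>, the weight \<open>1 - \<epsilon>\<^sup>2/2 h\<close> is an eigenfunction of the tilted transition operator.\<close>

lemma tilted_step:
  assumes a: "a \<in> S" and \<epsilon>: "\<bar>\<epsilon>\<bar> \<le> 1" and \<sigma>2: "0 \<le> \<sigma>2"
    and h: "\<And>a. a \<in> S \<Longrightarrow> (\<Sum>b\<in>S. P a b * (D a b)\<^sup>2) = \<sigma>2 + h a - (\<Sum>b\<in>S. P a b * h b)"
    and H: "\<And>a. a \<in> S \<Longrightarrow> \<bar>h a\<bar> \<le> H"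
  shows "cmod ((\<Sum>b\<in>S. P a b *\<^sub>R (iexp (\<epsilon> * D a b) * complex_of_real (1 - \<epsilon>\<^sup>2 / 2 * h b)))
      - complex_of_real ((1 - \<epsilon>\<^sup>2 * \<sigma>2 / 2) * (1 - \<epsilon>\<^sup>2 / 2 * h a)))
    \<le> (C ^ 3 / 6 + H * C / 2 + \<sigma>2 * H / 4) * \<bar>\<epsilon>\<bar> ^ 3"
proof -
  \<comment> \<open>Two Taylor remainders of the exponential: the constant weight needs the
    expansion to second order, while the term with \<open>h\<close> already carries
    \<open>\<epsilon>\<^sup>2\<close>, so order zero suffices there.\<close>
  define e where "e = (\<lambda>b. iexp (\<epsilon> * D a b) - (1 + \<i> * (\<epsilon> * D a b) - (\<epsilon> * D a b)\<^sup>2 / 2))"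
  define f where "f = (\<lambda>b. iexp (\<epsilon> * D a b) - 1)"
  have H0: "0 \<le> H" using H[OF a] by linarith
  have e: "cmod (e b) \<le> C ^ 3 / 6 * \<bar>\<epsilon>\<bar> ^ 3" if b: "b \<in> S" for b
  proof -
    have "cmod (e b) \<le> \<bar>\<epsilon> * D a b\<bar> ^ 3 / 6"
      using iexp_approx1[of "\<epsilon> * D a b" 2]
      by (simp add: e_def numeral_eq_Suc field_simps power2_eq_square)
    also have "\<dots> \<le> (\<bar>\<epsilon>\<bar> * C) ^ 3 / 6"
      using D_bound[OF a b] by (intro divide_right_mono power_mono) (auto simp: abs_mult intro!: mult_left_mono)
    finally show ?thesis by (simp add: power_mult_distrib mult.commute)
  qed
  have f: "cmod (f b) \<le> C * \<bar>\<epsilon>\<bar>" if b: "b \<in> S" for b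
  proof -
    have "cmod (f b) \<le> \<bar>\<epsilon> * D a b\<bar>"
      using iexp_approx1[of "\<epsilon> * D a b" 0] by (simp add: f_def)
    also have "\<dots> \<le> C * \<bar>\<epsilon>\<bar>"
      using D_bound[OF a b] by (simp add: abs_mult mult.commute[of C] mult_left_mono)
    finally show ?thesis .
  qed
  define r where "r = (\<lambda>b. e b - complex_of_real (\<epsilon>\<^sup>2 / 2 * h b) * f b)"
  have r: "cmod (r b) \<le> (C ^ 3 / 6 + H * C / 2) * \<bar>\<epsilon>\<bar> ^ 3" if b: "b \<in> S" for b
  proof -
    have "cmod (r b) \<le> cmod (e b) + \<epsilon>\<^sup>2 / 2 * \<bar>h b\<bar> * cmod (f b)"
      unfolding r_def by (rule order_trans[OF norm_triangle_ineq4]) (simp add: norm_mult abs_mult norm_power)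
    also have "\<dots> \<le> C ^ 3 / 6 * \<bar>\<epsilon>\<bar> ^ 3 + \<epsilon>\<^sup>2 / 2 * H * (C * \<bar>\<epsilon>\<bar>)"
      using e[OF b] f[OF b] H[OF b] H0 C_nonneg by (intro add_mono mult_mono) auto
    also have "\<epsilon>\<^sup>2 / 2 * H * (C * \<bar>\<epsilon>\<bar>) = H * C / 2 * \<bar>\<epsilon>\<bar> ^ 3"
      by (simp add: power3_eq_cube power2_eq_square abs_mult_self_eq field_simps)
    finally show ?thesis by (simp add: algebra_simps)
  qed
  have expand: "iexp (\<epsilon> * D a b) * complex_of_real (1 - \<epsilon>\<^sup>2 / 2 * h b)
      = complex_of_real (1 - \<epsilon>\<^sup>2 / 2 * (D a b)\<^sup>2 - \<epsilon>\<^sup>2 / 2 * h b) + \<i> * complex_of_real (\<epsilon> * D a b) + r b" for b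
  proof -
    have expand: "z * (1 - A) = (1 - B - A) + w + ((z - (1 + w - B)) - A * (z - 1))" for z A B w :: complex
      by (simp add: algebra_simps)
    have sq: "(\<epsilon> * D a b)\<^sup>2 / 2 = \<epsilon>\<^sup>2 / 2 * (D a b)\<^sup>2"
      by (simp add: power_mult_distrib)
    show ?thesis
      unfolding r_def e_def f_def of_real_diff of_real_1 sq by (rule expand)
  qed
  have "(\<Sum>b\<in>S. P a b *\<^sub>R (iexp (\<epsilon> * D a b) * complex_of_real (1 - \<epsilon>\<^sup>2 / 2 * h b)))
      = complex_of_real (\<Sum>b\<in>S. P a b * (1 - \<epsilon>\<^sup>2 / 2 * (D a b)\<^sup>2 - \<epsilon>\<^sup>2 / 2 * h b))
        + \<i> * complex_of_real (\<Sum>b\<in>S. P a b * (\<epsilon> * D a b)) + (\<Sum>b\<in>S. P a b *\<^sub>R r b)"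
    unfolding expand by (simp add: scaleR_conv_of_real distrib_left sum.distrib sum_distrib_left mult_ac)
  also have "(\<Sum>b\<in>S. P a b * (\<epsilon> * D a b)) = 0"
    using mean_zero[OF a] by (simp add: mult.left_commute sum_distrib_left[symmetric])
  also have "(\<Sum>b\<in>S. P a b * (1 - \<epsilon>\<^sup>2 / 2 * (D a b)\<^sup>2 - \<epsilon>\<^sup>2 / 2 * h b))
      = (\<Sum>b\<in>S. P a b) - \<epsilon>\<^sup>2 / 2 * (\<Sum>b\<in>S. P a b * (D a b)\<^sup>2) - \<epsilon>\<^sup>2 / 2 * (\<Sum>b\<in>S. P a b * h b)"
    by (simp add: right_diff_distrib sum_subtractf sum_distrib_left mult_ac)
  \<comment> \<open>The equation for \<open>h\<close> trades the state-dependent variance for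
    \<open>\<sigma>2\<close>, leaving \<open>h a\<close> in the shape of the weight one step
    earlier.\<close>
  also have "\<dots> = 1 - \<epsilon>\<^sup>2 / 2 * (\<sigma>2 + h a)"
    by (simp add: h[OF a] row_sum[OF a] algebra_simps)
  finally have avg: "(\<Sum>b\<in>S. P a b *\<^sub>R (iexp (\<epsilon> * D a b) * complex_of_real (1 - \<epsilon>\<^sup>2 / 2 * h b)))
      = complex_of_real (1 - \<epsilon>\<^sup>2 / 2 * (\<sigma>2 + h a)) + \<i> * complex_of_real 0 + (\<Sum>b\<in>S. P a b *\<^sub>R r b)" .
  have "(\<Sum>b\<in>S. P a b *\<^sub>R (iexp (\<epsilon> * D a b) * complex_of_real (1 - \<epsilon>\<^sup>2 / 2 * h b)))
      - complex_of_real ((1 - \<epsilon>\<^sup>2 * \<sigma>2 / 2) * (1 - \<epsilon>\<^sup>2 / 2 * h a))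
      = (\<Sum>b\<in>S. P a b *\<^sub>R r b) - complex_of_real (\<epsilon> ^ 4 / 4 * \<sigma>2 * h a)"
  proof -
    \<comment> \<open>The product of the eigenvalue and the weight differs from the averaged value
      by this fourth-order cross term, which \<open>\<bar>\<epsilon>\<bar> \<le> 1\<close> lets
      third order absorb.\<close>
    have "\<epsilon> ^ 4 / 4 * \<sigma>2 * h a = (1 - \<epsilon>\<^sup>2 * \<sigma>2 / 2) * (1 - \<epsilon>\<^sup>2 / 2 * h a) - (1 - \<epsilon>\<^sup>2 / 2 * (\<sigma>2 + h a))"
      by (simp add: field_simps power2_eq_square power4_eq_xxxx)
    then show ?thesis
      unfolding avg by (simp only: of_real_diff) simp
  qed
  also have "cmod \<dots> \<le> cmod (\<Sum>b\<in>S. P a b *\<^sub>R r b) + \<bar>\<epsilon> ^ 4 / 4 * \<sigma>2 * h a\<bar>"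
    by (rule order_trans[OF norm_triangle_ineq4]) (simp only: norm_of_real order_refl)
  also have "cmod (\<Sum>b\<in>S. P a b *\<^sub>R r b) \<le> (\<Sum>b\<in>S. P a b * ((C ^ 3 / 6 + H * C / 2) * \<bar>\<epsilon>\<bar> ^ 3))"
    using a r nonneg by (intro sum_norm_le) (auto intro!: mult_left_mono)
  also have "\<dots> = (C ^ 3 / 6 + H * C / 2) * \<bar>\<epsilon>\<bar> ^ 3"
    using row_sum[OF a] by (simp add: sum_distrib_right[symmetric])
  also have "\<bar>\<epsilon> ^ 4 / 4 * \<sigma>2 * h a\<bar> \<le> \<sigma>2 * H / 4 * \<bar>\<epsilon>\<bar> ^ 3"
  proof -
    have "\<bar>\<epsilon> ^ 4 / 4 * \<sigma>2 * h a\<bar> = (\<sigma>2 / 4 * \<bar>h a\<bar>) * \<bar>\<epsilon>\<bar> ^ 4"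
      using \<sigma>2 by (simp add: abs_mult power_abs)
    also have "\<dots> \<le> (\<sigma>2 / 4 * H) * \<bar>\<epsilon>\<bar> ^ 3"
      using \<epsilon> \<sigma>2 H[OF a] H0 by (intro mult_mono power_decreasing) auto
    finally show ?thesis by simp
  qed
  finally show ?thesis by (simp add: algebra_simps)
qed

text \<open>\<open>U\<close> is the characteristic function with the weight inserted, and by
  \<open>tilted_step\<close> it is multiplied by \<open>\<rho>\<close> in each step up to an error
  \<open>K\<close>. Since \<open>\<bar>\<rho>\<bar> \<le> 1\<close>, the errors only add up.
  Removing the weight costs \<open>H / 2 * \<epsilon>\<^sup>2\<close> at time \<open>n\<close> and
  again at time 0.\<close>

lemma char_estimate:
  assumes \<epsilon>: "\<bar>\<epsilon>\<bar> \<le> 1" and \<sigma>2: "0 \<le> \<sigma>2" "\<epsilon>\<^sup>2 * \<sigma>2 \<le> 2"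
    and h: "\<And>a. a \<in> S \<Longrightarrow> (\<Sum>b\<in>S. P a b * (D a b)\<^sup>2) = \<sigma>2 + h a - (\<Sum>b\<in>S. P a b * h b)"
    and H: "\<And>a. a \<in> S \<Longrightarrow> \<bar>h a\<bar> \<le> H"
  shows "cmod ((LINT \<omega>|\<Omega>. iexp (\<epsilon> * M n \<omega>)) - complex_of_real ((1 - \<epsilon>\<^sup>2 * \<sigma>2 / 2) ^ n))
    \<le> H * \<epsilon>\<^sup>2 + real n * ((C ^ 3 / 6 + H * C / 2 + \<sigma>2 * H / 4) * \<bar>\<epsilon>\<bar> ^ 3)"
proof -
  define K where "K = (C ^ 3 / 6 + H * C / 2 + \<sigma>2 * H / 4) * \<bar>\<epsilon>\<bar> ^ 3"
  define \<rho> where "\<rho> = 1 - \<epsilon>\<^sup>2 * \<sigma>2 / 2"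
  define \<psi> where "\<psi> = (\<lambda>u a. iexp (\<epsilon> * u) * complex_of_real (1 - \<epsilon>\<^sup>2 / 2 * h a))"
  define U where "U = (\<lambda>n. LINT \<omega>|\<Omega>. \<psi> (M n \<omega>) (X n \<omega>))"
  have \<rho>: "\<bar>\<rho>\<bar> \<le> 1" using \<sigma>2 by (auto simp: \<rho>_def abs_le_iff)
  have norm_le: "cmod (LINT \<omega>|\<Omega>. F (M n \<omega>) (X n \<omega>)) \<le> c"
    if "\<And>u a. a \<in> S \<Longrightarrow> cmod (F u a) \<le> c" for F c n
  proof -
    have "cmod (LINT \<omega>|\<Omega>. F (M n \<omega>) (X n \<omega>)) \<le> (LINT \<omega>|\<Omega>. cmod (F (M n \<omega>) (X n \<omega>)))"
      by (rule integral_norm_bound)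
    also have "\<dots> \<le> (LINT \<omega>|\<Omega>. c)"
      using that X_in by (intro integral_mono integrable_mart[where F = "\<lambda>u a. cmod (F u a)"]) auto
    finally show ?thesis by (simp add: prob_space)
  qed
  have step: "cmod (U (Suc n) - \<rho> * U n) \<le> K" for n
  proof -
    let ?T = "\<lambda>u a. \<Sum>b\<in>S. P a b *\<^sub>R \<psi> (u + D a b) b"
    have "U (Suc n) - \<rho> * U n = (LINT \<omega>|\<Omega>. ?T (M n \<omega>) (X n \<omega>)) - (LINT \<omega>|\<Omega>. \<rho> * \<psi> (M n \<omega>) (X n \<omega>))"
      by (simp add: U_def expectation_mart_Suc)
    also have "\<dots> = (LINT \<omega>|\<Omega>. ?T (M n \<omega>) (X n \<omega>) - \<rho> * \<psi> (M n \<omega>) (X n \<omega>))"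
      by (intro Bochner_Integration.integral_diff[symmetric] integrable_mart[where F = ?T]
          integrable_mart[where F = "\<lambda>u a. \<rho> * \<psi> u a"])
    also have "cmod \<dots> \<le> K"
    proof (rule norm_le[of "\<lambda>u a. ?T u a - \<rho> * \<psi> u a"])
      fix u a assume a: "a \<in> S"
      have "?T u a - \<rho> * \<psi> u a = iexp (\<epsilon> * u) *
          ((\<Sum>b\<in>S. P a b *\<^sub>R (iexp (\<epsilon> * D a b) * complex_of_real (1 - \<epsilon>\<^sup>2 / 2 * h b)))
            - complex_of_real ((1 - \<epsilon>\<^sup>2 * \<sigma>2 / 2) * (1 - \<epsilon>\<^sup>2 / 2 * h a)))"
        by (simp add: \<psi>_def \<rho>_def right_diff_distrib sum_distrib_left distrib_left exp_add
            scaleR_conv_of_real mult_ac)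
      then show "cmod (?T u a - \<rho> * \<psi> u a) \<le> K"
        using tilted_step[OF a \<epsilon> \<sigma>2(1) h H] by (simp add: norm_mult K_def)
    qed
    finally show ?thesis .
  qed
  have iter: "cmod (U n - \<rho> ^ n * U 0) \<le> real n * K" for n
  proof (induction n)
    case (Suc n)
    have "U (Suc n) - \<rho> ^ Suc n * U 0 = (U (Suc n) - \<rho> * U n) + \<rho> * (U n - \<rho> ^ n * U 0)"
      by (simp add: algebra_simps)
    also have "cmod \<dots> \<le> K + \<bar>\<rho>\<bar> * cmod (U n - \<rho> ^ n * U 0)"
      by (rule order_trans[OF norm_triangle_ineq]) (use step[of n] in \<open>simp add: norm_mult\<close>)
    also have "\<dots> \<le> K + 1 * (real n * K)"
      using \<rho> Suc by (intro add_left_mono mult_mono) auto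
    finally show ?case by (simp add: algebra_simps)
  qed simp
  have corr: "cmod ((LINT \<omega>|\<Omega>. iexp (\<epsilon> * M n \<omega>)) - U n) \<le> H / 2 * \<epsilon>\<^sup>2" for n
  proof -
    have "(LINT \<omega>|\<Omega>. iexp (\<epsilon> * M n \<omega>)) - U n = (LINT \<omega>|\<Omega>. iexp (\<epsilon> * M n \<omega>) - \<psi> (M n \<omega>) (X n \<omega>))"
      unfolding U_def
      by (intro Bochner_Integration.integral_diff[symmetric] integrable_mart[where F = \<psi>]
          integrable_mart[where F = "\<lambda>u a. iexp (\<epsilon> * u)"])
    also have "cmod \<dots> \<le> H / 2 * \<epsilon>\<^sup>2"
    proof (rule norm_le[of "\<lambda>u a. iexp (\<epsilon> * u) - \<psi> u a"])
      fix u a assume a: "a \<in> S"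
      have eq: "iexp (\<epsilon> * u) - \<psi> u a = iexp (\<epsilon> * u) * complex_of_real (\<epsilon>\<^sup>2 / 2 * h a)"
        by (simp add: \<psi>_def algebra_simps)
      have "cmod (iexp (\<epsilon> * u) - \<psi> u a) = \<bar>h a\<bar> * (\<epsilon>\<^sup>2 / 2)"
        unfolding eq norm_mult norm_of_real by (simp add: abs_mult)
      also have "\<dots> \<le> H * (\<epsilon>\<^sup>2 / 2)" using H[OF a] by (intro mult_right_mono) auto
      finally show "cmod (iexp (\<epsilon> * u) - \<psi> u a) \<le> H / 2 * \<epsilon>\<^sup>2" by simp
    qed
    finally show ?thesis .
  qed
  \<comment> \<open>The martingale starts at 0, so at time 0 the unweighted expectation is
    1.\<close>
  have "cmod (1 - U 0) \<le> H / 2 * \<epsilon>\<^sup>2"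
    using corr[of 0] by (simp add: prob_space)
  then have "cmod (\<rho> ^ n * U 0 - \<rho> ^ n) \<le> H / 2 * \<epsilon>\<^sup>2"
  proof -
    have "\<rho> ^ n * U 0 - \<rho> ^ n = - (\<rho> ^ n * (1 - U 0))"
      by (simp add: algebra_simps)
    then have "cmod (\<rho> ^ n * U 0 - \<rho> ^ n) = \<bar>\<rho>\<bar> ^ n * cmod (1 - U 0)"
      by (simp only: norm_minus_cancel norm_mult norm_of_real power_abs)
    also have "\<dots> \<le> 1 * cmod (1 - U 0)"
      using \<rho> by (intro mult_right_mono power_le_one) auto
    finally show ?thesis using \<open>cmod (1 - U 0) \<le> H / 2 * \<epsilon>\<^sup>2\<close> by simp
  qed
  moreover have "cmod (a - d) \<le> cmod (a - b) + cmod (b - c) + cmod (c - d)" for a b c d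
    using norm_triangle_ineq[of "(a - b) + (b - c)" "c - d"] norm_triangle_ineq[of "a - b" "b - c"] by simp
  note this[of "LINT \<omega>|\<Omega>. iexp (\<epsilon> * M n \<omega>)" "complex_of_real (\<rho> ^ n)" "U n" "\<rho> ^ n * U 0"]
  ultimately show ?thesis
    using corr[of n] iter[of n] unfolding \<rho>_def[symmetric] K_def[symmetric] by linarith
qed

text \<open>With \<open>\<epsilon> = t / sqrt (n * \<sigma>2)\<close> the power in
  \<open>char_estimate\<close> is \<open>(1 - t^2 / (2 n))^n\<close>, and the error vanishes because
  \<open>n * \<epsilon>\<^sup>2\<close> is constant for positive \<open>n\<close>, so that
  \<open>n * \<bar>\<epsilon>\<bar> ^ 3\<close> is a multiple of
  \<open>\<bar>\<epsilon>\<bar>\<close>.\<close>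

lemma char_limit:
  assumes \<sigma>2: "0 < \<sigma>2"
    and h: "\<And>a. a \<in> S \<Longrightarrow> (\<Sum>b\<in>S. P a b * (D a b)\<^sup>2) = \<sigma>2 + h a - (\<Sum>b\<in>S. P a b * h b)"
  shows "(\<lambda>n. LINT \<omega>|\<Omega>. iexp (t / sqrt (real n * \<sigma>2) * M n \<omega>)) \<longlonglongrightarrow> exp (- (t\<^sup>2) / 2)"
proof -
  define H where "H = (\<Sum>a\<in>S. \<bar>h a\<bar>)"
  have H: "\<bar>h a\<bar> \<le> H" if "a \<in> S" for a
    unfolding H_def using that finite_states by (intro member_le_sum) auto
  define K where "K = C ^ 3 / 6 + H * C / 2 + \<sigma>2 * H / 4"
  define \<epsilon> where "\<epsilon> = (\<lambda>n. t / sqrt (real n * \<sigma>2))"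
  define err where "err = (\<lambda>n. H * (\<epsilon> n)\<^sup>2 + real n * (K * \<bar>\<epsilon> n\<bar> ^ 3))"
  have sq: "(\<epsilon> n)\<^sup>2 * \<sigma>2 = t\<^sup>2 / real n" for n
    using \<sigma>2 by (simp add: \<epsilon>_def power_divide real_sqrt_pow2)
  have sqrt0: "(\<lambda>n. 1 / sqrt (real n)) \<longlonglongrightarrow> 0"
    by (intro tendsto_divide_0[OF tendsto_const] filterlim_at_top_imp_at_infinity
        filterlim_compose[OF sqrt_at_top] filterlim_real_sequentially)
  have \<epsilon>_eq: "\<epsilon> n = t / sqrt \<sigma>2 * (1 / sqrt (real n))" for n
    by (simp add: \<epsilon>_def real_sqrt_mult)
  have \<epsilon>0: "\<epsilon> \<longlonglongrightarrow> 0"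
    unfolding \<epsilon>_eq[abs_def] using sqrt0 by (rule tendsto_mult_right_zero)
  have "real n * (K * \<bar>\<epsilon> n\<bar> ^ 3) = K * (t\<^sup>2 / \<sigma>2) * \<bar>\<epsilon> n\<bar>" if "n > 0" for n
  proof -
    have "(\<epsilon> n)\<^sup>2 = t\<^sup>2 / real n / \<sigma>2"
      using \<sigma>2 by (simp add: sq[symmetric])
    moreover have "\<bar>\<epsilon> n\<bar> ^ 3 = (\<epsilon> n)\<^sup>2 * \<bar>\<epsilon> n\<bar>"
      by (simp add: power3_eq_cube power2_eq_square abs_mult_self_eq)
    ultimately show ?thesis using that by simp
  qed
  then have "\<forall>\<^sub>F n in sequentially. H * (\<epsilon> n)\<^sup>2 + K * (t\<^sup>2 / \<sigma>2) * \<bar>\<epsilon> n\<bar> = err n"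
    by (intro eventually_mono[OF eventually_gt_at_top[of 0]]) (simp add: err_def)
  moreover have "(\<lambda>n. H * (\<epsilon> n)\<^sup>2 + K * (t\<^sup>2 / \<sigma>2) * \<bar>\<epsilon> n\<bar>) \<longlonglongrightarrow> H * 0\<^sup>2 + K * (t\<^sup>2 / \<sigma>2) * \<bar>0\<bar>"
    by (intro tendsto_intros \<epsilon>0)
  ultimately have err0: "err \<longlonglongrightarrow> 0"
    using Lim_transform_eventually by fastforce
  have small: "\<forall>\<^sub>F n in sequentially. \<bar>\<epsilon> n\<bar> < 1" "\<forall>\<^sub>F n in sequentially. (\<epsilon> n)\<^sup>2 * \<sigma>2 < 2"
    using tendsto_rabs[OF \<epsilon>0] tendsto_mult[OF tendsto_power[OF \<epsilon>0, of 2] tendsto_const[of \<sigma>2]]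
    by (auto dest: order_tendstoD(2)[of _ 0 _ 1] order_tendstoD(2)[of _ 0 _ 2])
  have "\<forall>\<^sub>F n in sequentially. cmod ((LINT \<omega>|\<Omega>. iexp (\<epsilon> n * M n \<omega>)) - complex_of_real ((1 + (- (t\<^sup>2) / 2) / real n) ^ n)) \<le> err n"
    using small
  proof eventually_elim
    case (elim n)
    have "cmod ((LINT \<omega>|\<Omega>. iexp (\<epsilon> n * M n \<omega>)) - complex_of_real ((1 - (\<epsilon> n)\<^sup>2 * \<sigma>2 / 2) ^ n)) \<le> err n"
      unfolding err_def K_def by (rule char_estimate[OF _ _ _ h H]) (use elim \<sigma>2 in auto)
    moreover have "1 - (\<epsilon> n)\<^sup>2 * \<sigma>2 / 2 = 1 + (- (t\<^sup>2) / 2) / real n"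
      unfolding sq by simp
    ultimately show ?case by metis
  qed
  then have "(\<lambda>n. (LINT \<omega>|\<Omega>. iexp (\<epsilon> n * M n \<omega>)) - complex_of_real ((1 + (- (t\<^sup>2) / 2) / real n) ^ n)) \<longlonglongrightarrow> 0"
    by (rule Lim_null_comparison[OF _ err0])
  then show ?thesis
    unfolding \<epsilon>_def by (rule Lim_transform[rotated])
      (intro tendsto_of_real tendsto_exp_limit_sequentially)
qed

end

section \<open>Limit theorems for additive functionals\<close>

text \<open>Regroups a product evaluated from the left into nested one-step averages.\<close>

lemma row_col_vec_mat:
  "row_col S (vec_mat S v A) u = (\<Sum>a\<in>S. v a * (\<Sum>b\<in>S. A a b * u b))"
  unfolding row_col_def vec_mat_def sum_distrib_left sum_distrib_right
  by (subst sum.swap) (simp add: mult.assoc)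

context doeblin_matrix
begin

context
  fixes w :: "'a \<Rightarrow> 'a \<Rightarrow> real" and \<pi> :: "'a \<Rightarrow> real"
  assumes st: "stationary_distribution S P \<pi>"
begin

section \<open>Corrector and asymptotic variance\<close>

definition corrector :: "'a \<Rightarrow> real" where
  "corrector a = (\<Sum>b\<in>S. (fundamental_matrix S P \<pi> a b - \<pi> b) * (\<Sum>c\<in>S. P b c * w b c))"

definition increment :: "'a \<Rightarrow> 'a \<Rightarrow> real" where
  "increment a b = w a b - mean_param S P w \<pi> + corrector b - corrector a"

lemma inverse_fundamental: "is_mat_inverse S (fundamental_base P \<pi>) (fundamental_matrix S P \<pi>)"
  unfolding fundamental_matrix_def
  by (rule is_mat_inverse_mat_inverse[OF invertible_fundamental_base[OF st]])

lemma mean_param_eq: "mean_param S P w \<pi> = (\<Sum>a\<in>S. \<pi> a * (\<Sum>b\<in>S. P a b * w a b))"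
  by (simp add: mean_param_def row_col_vec_mat hadamard_def)

text \<open>Evaluated from the right, the triple product in the definition contains
  \<open>Z - 1 \<pi>\<close> applied to the one-step mean payoff, and this is
  \<open>corrector\<close>.\<close>

lemma variance_param_eq:
  "variance_param S P w \<pi> = (\<Sum>a\<in>S. \<pi> a * (\<Sum>b\<in>S. P a b * (w a b)\<^sup>2)) - (mean_param S P w \<pi>)\<^sup>2
    + 2 * (\<Sum>a\<in>S. \<pi> a * (\<Sum>b\<in>S. P a b * w a b * corrector b))"
proof -
  have "row_col S (vec_mat S (vec_mat S (vec_mat S \<pi> (hadamard P w))
        (\<lambda>a b. fundamental_matrix S P \<pi> a b - \<pi> b)) (hadamard P w)) (\<lambda>_. 1)
      = row_col S (vec_mat S (vec_mat S \<pi> (hadamard P w)) (\<lambda>a b. fundamental_matrix S P \<pi> a b - \<pi> b))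
          (\<lambda>b. \<Sum>c\<in>S. P b c * w b c)"
    by (subst row_col_vec_mat) (simp only: hadamard_def mult_1_right row_col_def)
  also have "\<dots> = row_col S (vec_mat S \<pi> (hadamard P w)) corrector"
    unfolding row_col_vec_mat[of _ "vec_mat S \<pi> (hadamard P w)"] by (simp only: row_col_def corrector_def)
  also have "\<dots> = (\<Sum>a\<in>S. \<pi> a * (\<Sum>b\<in>S. P a b * w a b * corrector b))"
    by (simp only: row_col_vec_mat hadamard_def)
  finally show ?thesis
    by (simp add: variance_param_def Let_def mean_param_def row_col_vec_mat[of _ \<pi>] hadamard_def
        power2_eq_square mult.assoc)
qed

lemma corrector_poisson:
  assumes "a \<in> S"
  shows "(\<Sum>b\<in>S. P a b * w a b) + (\<Sum>b\<in>S. P a b * corrector b) = mean_param S P w \<pi> + corrector a"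
  using poisson_equation(1)[OF st inverse_fundamental assms, of "\<lambda>b. \<Sum>c\<in>S. P b c * w b c"]
  by (simp add: corrector_def[abs_def] mean_param_eq)

lemma increment_mean_zero:
  assumes "a \<in> S"
  shows "(\<Sum>b\<in>S. P a b * increment a b) = 0"
proof -
  have "(\<Sum>b\<in>S. P a b * increment a b) = (\<Sum>b\<in>S. P a b * w a b) + (\<Sum>b\<in>S. P a b * corrector b)
      - (\<Sum>b\<in>S. P a b) * (mean_param S P w \<pi> + corrector a)"
    unfolding sum_distrib_right
    by (simp add: increment_def algebra_simps sum.distrib sum_subtractf)
  then show ?thesis using corrector_poisson[OF assms] row_sum[OF assms] by simp
qed

text \<open>The conditional second moment is that of \<open>w a b + corrector b\<close> minus the
  square of its conditional mean. Under \<open>\<pi>\<close> the squares of the corrector cancel by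
  invariance and its mean vanishes; what is left is the variance formula.\<close>

lemma increment_second_moment:
  "(\<Sum>a\<in>S. \<pi> a * (\<Sum>b\<in>S. P a b * (increment a b)\<^sup>2)) = variance_param S P w \<pi>"
proof -
  define \<mu> where "\<mu> = mean_param S P w \<pi>"
  define f where "f = (\<lambda>a. \<Sum>b\<in>S. P a b * w a b)"
  define Pg where "Pg = (\<lambda>a. \<Sum>b\<in>S. P a b * corrector b)"
  define W2 where "W2 = (\<lambda>a. \<Sum>b\<in>S. P a b * (w a b)\<^sup>2)"
  define Wg where "Wg = (\<lambda>a. \<Sum>b\<in>S. P a b * w a b * corrector b)"
  define G2 where "G2 = (\<lambda>a. \<Sum>b\<in>S. P a b * (corrector b)\<^sup>2)"
  have cond: "(\<Sum>b\<in>S. P a b * (increment a b)\<^sup>2)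
      = W2 a + 2 * Wg a + G2 a - \<mu>\<^sup>2 - 2 * \<mu> * corrector a - (corrector a)\<^sup>2" if a: "a \<in> S" for a
  proof -
    \<comment> \<open>By the Poisson equation this is the conditional mean of
      \<open>w a b + corrector b\<close>.\<close>
    define c where "c = \<mu> + corrector a"
    have "(\<Sum>b\<in>S. P a b * (increment a b)\<^sup>2)
        = (\<Sum>b\<in>S. P a b * (w a b)\<^sup>2 + 2 * (P a b * w a b * corrector b) + P a b * (corrector b)\<^sup>2
            - (2 * c) * (P a b * w a b) - (2 * c) * (P a b * corrector b) + c\<^sup>2 * P a b)"
      by (intro sum.cong refl)
        (simp add: increment_def c_def \<mu>_def power2_eq_square algebra_simps)
    also have "\<dots> = W2 a + 2 * Wg a + G2 a - (2 * c) * (f a + Pg a) + c\<^sup>2 * (\<Sum>b\<in>S. P a b)"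
      by (simp add: W2_def Wg_def G2_def f_def Pg_def sum.distrib sum_subtractf sum_distrib_left[symmetric]
          distrib_left)
    also have "f a + Pg a = c"
      using corrector_poisson[OF a] by (simp add: f_def Pg_def c_def \<mu>_def)
    finally show ?thesis
      using row_sum[OF a] by (simp add: c_def power2_eq_square algebra_simps)
  qed
  have "(\<Sum>a\<in>S. \<pi> a * (\<Sum>b\<in>S. P a b * (increment a b)\<^sup>2))
      = (\<Sum>a\<in>S. \<pi> a * W2 a + 2 * (\<pi> a * Wg a) + \<pi> a * G2 a - \<mu>\<^sup>2 * \<pi> a
          - (2 * \<mu>) * (\<pi> a * corrector a) - \<pi> a * (corrector a)\<^sup>2)"
    by (intro sum.cong refl) (simp add: cond algebra_simps)
  also have "\<dots> = (\<Sum>a\<in>S. \<pi> a * W2 a) + 2 * (\<Sum>a\<in>S. \<pi> a * Wg a) + (\<Sum>a\<in>S. \<pi> a * G2 a)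
      - \<mu>\<^sup>2 * (\<Sum>a\<in>S. \<pi> a) - (2 * \<mu>) * (\<Sum>a\<in>S. \<pi> a * corrector a) - (\<Sum>a\<in>S. \<pi> a * (corrector a)\<^sup>2)"
    by (simp only: sum.distrib sum_subtractf sum_distrib_left)
  also have "(\<Sum>a\<in>S. \<pi> a * G2 a) = (\<Sum>a\<in>S. \<pi> a * (corrector a)\<^sup>2)"
    unfolding G2_def by (rule stationary_sum[OF st])
  also have "(\<Sum>a\<in>S. \<pi> a * corrector a) = 0"
    using poisson_equation(2)[OF st inverse_fundamental, of "\<lambda>b. \<Sum>c\<in>S. P b c * w b c"]
    by (simp add: corrector_def[abs_def])
  also have "(\<Sum>a\<in>S. \<pi> a) = 1"
    using st by (simp add: stationary_distribution_def)
  finally show ?thesis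
    by (simp add: variance_param_eq W2_def Wg_def \<mu>_def)
qed

lemma ex_increment_bound: "\<exists>C. \<forall>a\<in>S. \<forall>b\<in>S. \<bar>increment a b\<bar> \<le> C"
proof (intro exI ballI)
  fix a b assume "a \<in> S" "b \<in> S"
  then show "\<bar>increment a b\<bar> \<le> Max ((\<lambda>(a, b). \<bar>increment a b\<bar>) ` (S \<times> S))"
    using finite_states by (intro Max_ge) auto
qed

text \<open>The correctors telescope, so the centred sum is the martingale plus
  \<open>corrector (X 0 \<omega>) - corrector (X n \<omega>)\<close>. This boundary term is bounded
  by a constant, so it disappears under either normalisation, and Levy continuity turns
  \<open>char_limit\<close> into weak convergence.\<close>

theorem additive_functional_limits:
  fixes \<Omega> :: "'w measure"
  assumes mc: "markov_chain \<Omega> S P X"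
  defines "Sn \<equiv> \<lambda>n \<omega>. \<Sum>k<n. w (X k \<omega>) (X (Suc k) \<omega>)"
  shows "AE \<omega> in \<Omega>. (\<lambda>n. Sn n \<omega> / real n) \<longlonglongrightarrow> mean_param S P w \<pi>" (is "?SLLN")
    and "variance_param S P w \<pi> > 0 \<Longrightarrow>
      weak_conv_m (\<lambda>n. distr \<Omega> borel (\<lambda>\<omega>. (Sn n \<omega> - real n * mean_param S P w \<pi>)
        / sqrt (real n * variance_param S P w \<pi>))) std_normal_distribution" (is "_ \<Longrightarrow> ?CLT")
proof -
  define \<mu> where "\<mu> = mean_param S P w \<pi>"
  define \<sigma>2 where "\<sigma>2 = variance_param S P w \<pi>"
  obtain C where C: "\<And>a b. a \<in> S \<Longrightarrow> b \<in> S \<Longrightarrow> \<bar>increment a b\<bar> \<le> C"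
    using ex_increment_bound by blast
  interpret markov_martingale S P \<Omega> X increment C
    by unfold_locales (use mc C increment_mean_zero in auto)
  define c where "c = (\<lambda>n \<omega>. corrector (X 0 \<omega>) - corrector (X n \<omega>))"
  define G where "G = 2 * (\<Sum>a\<in>S. \<bar>corrector a\<bar>)"
  have G: "\<bar>c n \<omega>\<bar> \<le> G" if "\<omega> \<in> space \<Omega>" for n \<omega>
  proof -
    have "\<bar>corrector a\<bar> \<le> (\<Sum>a\<in>S. \<bar>corrector a\<bar>)" if "a \<in> S" for a
      using that finite_states by (intro member_le_sum) auto
    from this[OF X_in[OF that, of 0]] this[OF X_in[OF that, of n]] show ?thesis
      unfolding c_def G_def by linarith
  qed
  have Sn: "Sn n \<omega> = real n * \<mu> + M n \<omega> + c n \<omega>" for n \<omega>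
    unfolding Sn_def c_def mart_def
    by (induction n) (simp_all add: increment_def \<mu>_def algebra_simps)
  have c_meas: "c n \<in> borel_measurable \<Omega>" for n
    unfolding c_def
    by (intro borel_measurable_diff measurable_compose[OF X_measurable]) auto
  have Sn_meas: "Sn n \<in> borel_measurable \<Omega>" for n
  proof -
    note c_meas [measurable]
    show ?thesis unfolding Sn[abs_def] by measurable
  qed
  have "AE \<omega> in \<Omega>. \<omega> \<in> space \<Omega>" by simp
  with strong_law show ?SLLN
  proof eventually_elim
    case (elim \<omega>)
    have "(\<lambda>n. c n \<omega> / real n) \<longlonglongrightarrow> 0"
    proof (rule Lim_null_comparison)
      show "\<forall>\<^sub>F n in sequentially. norm (c n \<omega> / real n) \<le> G / real n"
        using G[OF elim(2)] by (auto intro!: always_eventually divide_right_mono)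
      show "(\<lambda>n. G / real n) \<longlonglongrightarrow> 0" by (rule lim_const_over_n)
    qed
    from tendsto_add[OF tendsto_add[OF tendsto_const[of \<mu>] elim(1)] this]
    have "(\<lambda>n. \<mu> + M n \<omega> / real n + c n \<omega> / real n) \<longlonglongrightarrow> \<mu>" by simp
    moreover have "\<forall>\<^sub>F n in sequentially. \<mu> + M n \<omega> / real n + c n \<omega> / real n = Sn n \<omega> / real n"
      by (intro eventually_mono[OF eventually_gt_at_top[of 0]]) (simp add: Sn add_divide_distrib)
    ultimately show ?case
      unfolding \<mu>_def[symmetric] by (rule Lim_transform_eventually)
  qed
  assume "variance_param S P w \<pi> > 0"
  then have \<sigma>2: "0 < \<sigma>2" by (simp add: \<sigma>2_def)
  \<comment> \<open>\<open>v\<close> is the conditional variance of a step and \<open>h\<close> its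
    own Poisson solution; the \<open>\<pi>\<close>-mean of \<open>v\<close> is
    \<open>\<sigma>2\<close> by \<open>increment_second_moment\<close>.\<close>
  define v where "v = (\<lambda>a. \<Sum>b\<in>S. P a b * (increment a b)\<^sup>2)"
  define h where "h = (\<lambda>a. \<Sum>b\<in>S. (fundamental_matrix S P \<pi> a b - \<pi> b) * v b)"
  have h: "(\<Sum>b\<in>S. P a b * (increment a b)\<^sup>2) = \<sigma>2 + h a - (\<Sum>b\<in>S. P a b * h b)" if "a \<in> S" for a
    using poisson_equation(1)[OF st inverse_fundamental that, of v] increment_second_moment
    by (simp add: h_def v_def \<sigma>2_def)
  define T where "T = (\<lambda>n \<omega>. (Sn n \<omega> - real n * \<mu>) / sqrt (real n * \<sigma>2))"
  have T_meas [measurable]: "T n \<in> borel_measurable \<Omega>" for n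
    unfolding T_def using Sn_meas by measurable
  have "(\<lambda>n. char (distr \<Omega> borel (T n)) t) \<longlonglongrightarrow> char std_normal_distribution t" for t
  proof -
    define \<epsilon> where "\<epsilon> = (\<lambda>n. t / sqrt (real n * \<sigma>2))"
    have bound: "cmod (char (distr \<Omega> borel (T n)) t - (LINT \<omega>|\<Omega>. iexp (\<epsilon> n * M n \<omega>))) \<le> \<bar>\<epsilon> n\<bar> * G" for n
    proof -
      have tT: "t * T n \<omega> = \<epsilon> n * M n \<omega> + \<epsilon> n * c n \<omega>" for \<omega>
        by (simp add: T_def \<epsilon>_def Sn add_divide_distrib distrib_left)
      have int: "integrable \<Omega> (\<lambda>\<omega>. iexp (t * T n \<omega>))" "integrable \<Omega> (\<lambda>\<omega>. iexp (\<epsilon> n * M n \<omega>))"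
        by (intro integrable_const_bound[where B = 1]; simp)+
      have "char (distr \<Omega> borel (T n)) t = (LINT \<omega>|\<Omega>. iexp (t * T n \<omega>))"
        unfolding char_def by (rule integral_distr) auto
      then have "cmod (char (distr \<Omega> borel (T n)) t - (LINT \<omega>|\<Omega>. iexp (\<epsilon> n * M n \<omega>)))
          = cmod (LINT \<omega>|\<Omega>. iexp (t * T n \<omega>) - iexp (\<epsilon> n * M n \<omega>))"
        using int by simp
      also have "\<dots> \<le> (LINT \<omega>|\<Omega>. cmod (iexp (t * T n \<omega>) - iexp (\<epsilon> n * M n \<omega>)))"
        by (rule integral_norm_bound)
      also have "\<dots> \<le> (LINT \<omega>|\<Omega>. \<bar>\<epsilon> n\<bar> * G)"
      proof (rule integral_mono)
        show "integrable \<Omega> (\<lambda>\<omega>. cmod (iexp (t * T n \<omega>) - iexp (\<epsilon> n * M n \<omega>)))"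
          using int by (intro integrable_norm Bochner_Integration.integrable_diff)
        fix \<omega> assume \<omega>: "\<omega> \<in> space \<Omega>"
        \<comment> \<open>Factoring out a number of modulus 1 leaves only the boundary term in the
          exponent.\<close>
        have "iexp (t * T n \<omega>) - iexp (\<epsilon> n * M n \<omega>) = iexp (\<epsilon> n * M n \<omega>) * (iexp (\<epsilon> n * c n \<omega>) - 1)"
          unfolding tT by (simp add: right_diff_distrib distrib_left exp_add)
        also have "cmod \<dots> \<le> \<bar>\<epsilon> n * c n \<omega>\<bar>"
          unfolding norm_mult norm_exp_i_times using iexp_approx1[of "\<epsilon> n * c n \<omega>" 0] by simp
        also have "\<dots> \<le> \<bar>\<epsilon> n\<bar> * G"
          unfolding abs_mult by (intro mult_left_mono G \<omega>) simp
        finally show "cmod (iexp (t * T n \<omega>) - iexp (\<epsilon> n * M n \<omega>)) \<le> \<bar>\<epsilon> n\<bar> * G" .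
      qed simp
      finally show ?thesis by (simp add: prob_space)
    qed
    have "(\<lambda>n. \<bar>\<epsilon> n\<bar> * G) \<longlonglongrightarrow> 0"
    proof -
      have "(\<lambda>n. 1 / sqrt (real n)) \<longlonglongrightarrow> 0"
        by (intro tendsto_divide_0[OF tendsto_const] filterlim_at_top_imp_at_infinity
            filterlim_compose[OF sqrt_at_top] filterlim_real_sequentially)
      from tendsto_mult_left[OF this, of "t / sqrt \<sigma>2"] have "\<epsilon> \<longlonglongrightarrow> 0"
        by (simp add: \<epsilon>_def[abs_def] real_sqrt_mult mult.commute)
      from tendsto_mult[OF tendsto_rabs[OF this] tendsto_const[of G]] show ?thesis by simp
    qed
    then have "(\<lambda>n. char (distr \<Omega> borel (T n)) t - (LINT \<omega>|\<Omega>. iexp (\<epsilon> n * M n \<omega>))) \<longlonglongrightarrow> 0"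
      by (rule Lim_null_comparison[OF always_eventually[OF allI[OF bound]]])
    then show ?thesis
      unfolding char_std_normal_distribution \<epsilon>_def
      by (rule Lim_transform[rotated]) (rule char_limit[OF \<sigma>2 h])
  qed
  then have "weak_conv_m (\<lambda>n. distr \<Omega> borel (T n)) std_normal_distribution"
    by (intro levy_continuity real_distribution_distr real_dist_normal_dist T_meas)
  then show ?CLT
    by (simp only: T_def \<mu>_def \<sigma>2_def)
qed

end

end

section \<open>The torus chain\<close>

lemma finite_sites: "finite (sites M N)"
  by (simp add: sites_def)

lemma finite_configs: "finite (configs M N)"
  by (simp add: configs_def finite_sites finite_PiE)

lemma finite_aug_states: "finite (aug_states M N)"
  by (simp add: aug_states_def finite_configs)

lemma config_values: "x \<in> configs M N \<Longrightarrow> k \<in> sites M N \<Longrightarrow> x k = 0 \<or> x k = 1"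
  by (auto simp: configs_def)

lemma config_eqI:
  "x \<in> configs M N \<Longrightarrow> y \<in> configs M N \<Longrightarrow> (\<And>k. k \<in> sites M N \<Longrightarrow> x k = y k) \<Longrightarrow> x = y"
  unfolding configs_def by (rule PiE_ext)

lemma flip_in_configs: "x \<in> configs M N \<Longrightarrow> k \<in> sites M N \<Longrightarrow> flip x k \<in> configs M N"
  by (auto simp: configs_def flip_def PiE_iff extensional_def)

text \<open>Cyclic neighbours of a site are sites again, so \<open>p\<close> is only evaluated where
  its bounds are assumed.\<close>

lemma neighbour_sum_le:
  assumes "x \<in> configs M N" "k \<in> sites M N"
  shows "neighbour_sum M N x k \<le> 4"
proof -
  obtain i j where k: "k = (i, j)" by (cases k)
  have "(cyc_next M i, j) \<in> sites M N" "(cyc_prev M i, j) \<in> sites M N"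
    "(i, cyc_next N j) \<in> sites M N" "(i, cyc_prev N j) \<in> sites M N"
    using assms(2) by (auto simp: k sites_def cyc_next_def cyc_prev_def)
  from this[THEN config_values[OF assms(1)]] show ?thesis
    by (auto simp: k neighbour_sum_def)
qed

text \<open>A game with profit 1 leaves a 1 at the played site, and a loss leaves a 0. The excluded
  states are those in which no site can have been the last one played.\<close>

lemma accessible_iff:
  assumes "x \<in> configs M N" "t \<in> {-1, 1}"
  shows "(x, t) \<in> accessible_states M N \<longleftrightarrow> (\<exists>k\<in>sites M N. x k = (if t = 1 then 1 else 0))"
proof -
  have "const_config M N c \<in> configs M N" if "c \<in> {0, 1}" for c
    using that by (auto simp: const_config_def configs_def)
  then have eq: "x = const_config M N c \<longleftrightarrow> (\<forall>k\<in>sites M N. x k = c)" if "c \<in> {0, 1}" for c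
    using config_eqI[OF assms(1)] that by (auto simp: const_config_def)
  have "(\<exists>k\<in>sites M N. x k = 1) \<longleftrightarrow> \<not> (\<forall>k\<in>sites M N. x k = 0)"
    "(\<exists>k\<in>sites M N. x k = 0) \<longleftrightarrow> \<not> (\<forall>k\<in>sites M N. x k = 1)"
    using config_values[OF assms(1)] by (metis zero_neq_one)+
  then show ?thesis
    using assms eq[of 0] eq[of 1] by (auto simp: accessible_states_def aug_states_def simp del: bex_simps ball_simps)
qed

locale torus_chain =
  fixes M N :: nat and p :: "nat \<Rightarrow> real"
  assumes M_pos: "M > 0" and N_pos: "N > 0"
    and p_bounds: "m \<le> 4 \<Longrightarrow> 0 < p m \<and> p m < 1"
begin

abbreviation "P \<equiv> aug_trans M N p"

lemma p_neighbour:
  assumes "x \<in> configs M N" "k \<in> sites M N"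
  shows "0 < p (neighbour_sum M N x k)" "p (neighbour_sum M N x k) < 1"
  using p_bounds[OF neighbour_sum_le[OF assms]] by auto

lemma trans_nonneg:
  assumes "a \<in> aug_states M N"
  shows "0 \<le> P a b"
proof -
  obtain x s y t where ab: "a = (x, s)" "b = (y, t)" by (metis surj_pair)
  have x: "x \<in> configs M N" using assms by (simp add: ab aug_states_def)
  note le = p_neighbour[OF x, THEN less_imp_le]
  show ?thesis
    unfolding ab aug_trans_def prod.case using le
    by (intro divide_nonneg_nonneg) (auto intro!: sum_nonneg)
qed

text \<open>At each site \<open>stay\<close> and \<open>move\<close> have total weight 1, and there
  are \<open>M * N\<close> sites.\<close>

lemma trans_row_sum:
  assumes "a \<in> aug_states M N"
  shows "(\<Sum>b\<in>aug_states M N. P a b) = 1"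
proof -
  obtain x s where a: "a = (x, s)" by (cases a)
  have x: "x \<in> configs M N" using assms by (simp add: a aug_states_def)
  let ?q = "\<lambda>k. p (neighbour_sum M N x k)"
  define stay where "stay = (\<lambda>k. if x k = 1 then ?q k else 1 - ?q k)"
  define move where "move = (\<lambda>k. if x k = 1 then 1 - ?q k else ?q k)"
  have both: "P (x, s) (y, 1) + P (x, s) (y, -1)
      = (if y = x then (\<Sum>k\<in>sites M N. stay k) else (\<Sum>k\<in>{k \<in> sites M N. flip x k = y}. move k)) / real (M * N)" for y
  proof (cases "y = x")
    case True
    have split: "sites M N = {k \<in> sites M N. x k = 1} \<union> {k \<in> sites M N. x k = 0}"
      using config_values[OF x] by blast
    have "(\<Sum>k\<in>sites M N. stay k) = (\<Sum>k\<in>{k \<in> sites M N. x k = 1}. stay k) + (\<Sum>k\<in>{k \<in> sites M N. x k = 0}. stay k)"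
      by (subst (1) split, rule sum.union_disjoint) (auto simp: finite_sites)
    also have "\<dots> = (\<Sum>k\<in>{k \<in> sites M N. x k = 1}. ?q k) + (\<Sum>k\<in>{k \<in> sites M N. x k = 0}. 1 - ?q k)"
      by (intro arg_cong2[of _ _ _ _ "(+)"] sum.cong) (auto simp: stay_def)
    finally show ?thesis
      using True by (simp add: aug_trans_def add_divide_distrib)
  next
    case False
    have "P (x, s) (y, 1) + P (x, s) (y, -1) = (\<Sum>k\<in>{k \<in> sites M N. y = flip x k}.
        (if x k = 0 then ?q k else 0) + (if x k = 0 then 0 else 1 - ?q k)) / real (M * N)"
      using False by (simp add: aug_trans_def add_divide_distrib sum.distrib)
    also have "\<dots> = (\<Sum>k\<in>{k \<in> sites M N. flip x k = y}. move k) / real (M * N)"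
    proof (intro arg_cong2[of _ _ _ _ "(/)"] sum.cong refl)
      fix k assume "k \<in> {k \<in> sites M N. flip x k = y}"
      then show "(if x k = 0 then ?q k else 0) + (if x k = 0 then 0 else 1 - ?q k) = move k"
        using config_values[OF x, of k] by (auto simp: move_def)
    qed auto
    finally show ?thesis using False by simp
  qed
  have "(\<Sum>b\<in>aug_states M N. P a b) = (\<Sum>y\<in>configs M N. P (x, s) (y, 1) + P (x, s) (y, -1))"
    unfolding aug_states_def a by (simp add: sum.cartesian_product' add.commute)
  also have "\<dots> = (\<Sum>k\<in>sites M N. stay k) / real (M * N)
      + (\<Sum>y\<in>configs M N - {x}. (\<Sum>k\<in>{k \<in> sites M N. flip x k = y}. move k) / real (M * N))"
    unfolding both using x by (subst sum.remove[of _ x]) (auto simp: finite_configs)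
  also have "\<dots> = ((\<Sum>k\<in>sites M N. stay k)
      + (\<Sum>y\<in>configs M N - {x}. \<Sum>k\<in>{k \<in> sites M N. flip x k = y}. move k)) / real (M * N)"
    by (simp add: add_divide_distrib sum_divide_distrib)
  \<comment> \<open>Each site contributes to exactly one target, \<open>flip x k\<close>, which is
    never \<open>x\<close> itself.\<close>
  also have "(\<Sum>y\<in>configs M N - {x}. \<Sum>k\<in>{k \<in> sites M N. flip x k = y}. move k) = (\<Sum>k\<in>sites M N. move k)"
    using flip_in_configs[OF x] flip_neq
    by (intro sum.group) (auto simp: finite_sites finite_configs)
  also have "(\<Sum>k\<in>sites M N. stay k) + (\<Sum>k\<in>sites M N. move k) = (\<Sum>k\<in>sites M N. 1)"
    unfolding sum.distrib[symmetric] by (intro sum.cong) (auto simp: stay_def move_def)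
  also have "(\<Sum>k\<in>sites M N. 1) / real (M * N) = (1 :: real)"
    using M_pos N_pos by (simp add: sites_def)
  finally show ?thesis .
qed

sublocale stochastic_matrix "aug_states M N" P
  by unfold_locales (auto simp: finite_aug_states trans_nonneg trans_row_sum)

section \<open>Reachability, aperiodicity and minorization on the torus\<close>

lemma stay_pos:
  assumes "x \<in> configs M N" "(x, t) \<in> accessible_states M N"
  shows "P (x, s) (x, t) > 0"
proof -
  have t: "t \<in> {-1, 1}" using assms(2) by (simp add: accessible_states_def aug_states_def)
  obtain k where k: "k \<in> sites M N" "x k = (if t = 1 then 1 else 0)"
    using assms(2) accessible_iff[OF assms(1) t] by blast
  then have "{l \<in> sites M N. x l = (if t = 1 then 1 else 0)} \<noteq> {}" by blast
  then show ?thesis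
    using t p_neighbour[OF assms(1)] M_pos N_pos
    by (auto simp: aug_trans_def finite_sites intro!: divide_pos_pos sum_pos)
qed

lemma flip_pos:
  assumes "x \<in> configs M N" "k \<in> sites M N"
  obtains t where "(flip x k, t) \<in> accessible_states M N" "\<And>s. P (x, s) (flip x k, t) > 0"
proof -
  \<comment> \<open>The old entry forces the profit: changing 0 to 1 is a win, changing 1 to 0 a
    loss.\<close>
  define t where "t = (if x k = 0 then 1 else -1 :: int)"
  have "(flip x k, t) \<in> accessible_states M N"
    using accessible_iff[OF flip_in_configs[OF assms], of t] assms config_values[OF assms]
    by (auto simp: t_def flip_def intro!: bexI[of _ k])
  moreover have "P (x, s) (flip x k, t) > 0" for s
    using p_neighbour[OF assms] M_pos N_pos
    by (simp add: t_def aug_trans_flip_pos[OF assms(2)] aug_trans_flip_neg[OF assms(2)])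
  ultimately show thesis by (rule that)
qed

lemma accessible_subset: "accessible_states M N \<subseteq> aug_states M N"
  by (auto simp: accessible_states_def)

text \<open>Induction on the number of sites where the configurations differ; each flip corrects one
  of them. The set \<open>T\<close> is left open so that the argument applies both to the accessible
  states and to the whole state space.\<close>

lemma reach_config:
  assumes T: "accessible_states M N \<subseteq> T" "T \<subseteq> aug_states M N"
    and y: "y \<in> configs M N"
    and "b \<in> T" "mat_pow T P n a b > 0"
  shows "\<exists>n s. (y, s) \<in> T \<and> mat_pow T P n a (y, s) > 0"
  using assms(4,5)
proof (induction "card {k \<in> sites M N. fst b k \<noteq> y k}" arbitrary: b n rule: less_induct)
  case less
  have x: "fst b \<in> configs M N" using less.prems T by (auto simp: aug_states_def)
  show ?case
  proof (cases "fst b = y")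
    case True
    then show ?thesis using less.prems by (metis prod.collapse)
  next
    case False
    then obtain k where k: "k \<in> sites M N" "fst b k \<noteq> y k"
      using config_eqI[OF x y] by blast
    obtain t where t: "(flip (fst b) k, t) \<in> accessible_states M N" "\<And>s. P (fst b, s) (flip (fst b) k, t) > 0"
      using flip_pos[OF x k(1)] by blast
    have "mat_pow T P (Suc n) a (flip (fst b) k, t) > 0"
      using less.prems t(2)[of "snd b"] t(1) T finite_subset[OF T(2) finite_aug_states] trans_nonneg
      by (intro mat_pow_step_pos[of T P b]) auto
    moreover have "{l \<in> sites M N. flip (fst b) k l \<noteq> y l} \<subset> {l \<in> sites M N. fst b l \<noteq> y l}"
      using k config_values[OF x k(1)] config_values[OF y k(1)] by (auto simp: flip_def)
    then have "card {l \<in> sites M N. flip (fst b) k l \<noteq> y l} < card {l \<in> sites M N. fst b l \<noteq> y l}"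
      by (intro psubset_card_mono) (auto simp: finite_sites)
    ultimately show ?thesis
      using less.hyps[of "(flip (fst b) k, t)" "Suc n"] t(1) T by (auto simp del: mat_pow.simps)
  qed
qed

text \<open>First reach the configuration with whatever profit results, then use one step that keeps
  it and sets the profit to the desired value.\<close>

lemma reach_accessible:
  assumes T: "accessible_states M N \<subseteq> T" "T \<subseteq> aug_states M N"
    and "a \<in> T" "b \<in> accessible_states M N"
  shows "\<exists>n. mat_pow T P n a b > 0"
proof -
  obtain y t where b: "b = (y, t)" by (cases b)
  have y: "y \<in> configs M N"
    using assms(4) by (simp add: b accessible_states_def aug_states_def)
  have "mat_pow T P 0 a a > 0" by (simp add: mat_one_def)
  then obtain n s where n: "(y, s) \<in> T" "mat_pow T P n a (y, s) > 0"
    using reach_config[OF T y \<open>a \<in> T\<close>] by blast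
  have "mat_pow T P (Suc n) a b > 0"
    using n stay_pos[OF y, of t s] assms finite_subset[OF T(2) finite_aug_states] trans_nonneg
    by (intro mat_pow_step_pos[of T P "(y, s)"]) (auto simp: b)
  then show ?thesis by blast
qed

lemma self_loop: "b \<in> accessible_states M N \<Longrightarrow> P b b > 0"
  using stay_pos[of "fst b" "snd b" "snd b"]
  by (auto simp: accessible_states_def aug_states_def)

lemma irreducible: "irreducible_chain (accessible_states M N) P"
  unfolding irreducible_chain_def using reach_accessible[OF order_refl accessible_subset] by blast

lemma aperiodic: "aperiodic_chain (accessible_states M N) P"
  unfolding aperiodic_chain_def
proof
  fix a assume a: "a \<in> accessible_states M N"
  have "mat_pow (accessible_states M N) P 1 a a = P a a"
    using a finite_subset[OF accessible_subset finite_aug_states] by (simp add: mat_mult_one_left)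
  then have "1 \<in> {n. n > 0 \<and> mat_pow (accessible_states M N) P n a a > 0}"
    using self_loop[OF a] by simp
  then have "Gcd {n. n > 0 \<and> mat_pow (accessible_states M N) P n a a > 0} dvd 1"
    by (rule Gcd_dvd)
  then show "Gcd {n. n > 0 \<and> mat_pow (accessible_states M N) P n a a > 0} = 1"
    by simp
qed

text \<open>Since \<open>b\<close> has a self-loop, it can be reached from all states at a common time.\<close>

lemma minorization:
  obtains m b where "doeblin_matrix (aug_states M N) P m b"
proof -
  have "(1, 1) \<in> sites M N" using M_pos N_pos by (simp add: sites_def)
  moreover have "const_config M N 1 \<in> configs M N" by (auto simp: const_config_def configs_def)
  ultimately have b: "(const_config M N 1, 1) \<in> accessible_states M N"
    by (subst accessible_iff) (auto simp: const_config_def)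
  define b where "b = (const_config M N 1, 1 :: int)"
  have "\<forall>a\<in>aug_states M N. \<exists>n. mat_pow (aug_states M N) P n a b > 0"
    using reach_accessible[OF accessible_subset order_refl _ b] by (simp add: b_def)
  then obtain n where n: "\<And>a. a \<in> aug_states M N \<Longrightarrow> mat_pow (aug_states M N) P (n a) a b > 0"
    by metis
  have later: "mat_pow (aug_states M N) P (k + j) a b > 0"
    if "mat_pow (aug_states M N) P k a b > 0" for a k j
  proof (induction j)
    case (Suc j)
    have "mat_pow (aug_states M N) P (Suc (k + j)) a b > 0"
      using Suc b accessible_subset self_loop[OF b]
      by (intro mat_pow_step_pos[where b = b] finite_aug_states trans_nonneg) (auto simp: b_def)
    then show ?case by (simp del: mat_pow.simps)
  qed (use that in simp)
  \<comment> \<open>The sum dominates every hitting time \<open>n a\<close>, and the successor makes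
    \<open>m\<close> positive.\<close>
  define m where "m = Suc (\<Sum>a\<in>aug_states M N. n a)"
  have "mat_pow (aug_states M N) P m a b > 0" if a: "a \<in> aug_states M N" for a
  proof -
    have "n a \<le> m"
      unfolding m_def using member_le_sum[OF a, of n] finite_aug_states by fastforce
    then show ?thesis using later[OF n[OF a], of "m - n a"] by simp
  qed
  then have "doeblin_matrix (aug_states M N) P m b"
    using b accessible_subset by unfold_locales (auto simp: m_def b_def)
  then show thesis by (rule that)
qed

end

theorem theorem1:
  fixes M N :: nat and p :: "nat \<Rightarrow> real"
  assumes "M \<ge> 3" and "N \<ge> 3"
    and "\<And>m. m \<le> 4 \<Longrightarrow> 0 < p m \<and> p m < 1"
  defines "S \<equiv> aug_states M N"
    and "P \<equiv> aug_trans M N p"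
    and "w \<equiv> aug_payoff M N"
  shows
    "irreducible_chain (accessible_states M N) P \<and>
     aperiodic_chain (accessible_states M N) P \<and>
     (\<exists>!\<pi>. stationary_distribution S P \<pi>) \<and>
     (\<forall>\<pi>. stationary_distribution S P \<pi> \<longrightarrow>
        mat_invertible S (fundamental_base P \<pi>) \<and>
        (\<forall>(\<Omega> :: 'w measure) X.
           markov_chain \<Omega> S P X \<longrightarrow>
           (let \<mu> = mean_param S P w \<pi>;
                \<sigma>2 = variance_param S P w \<pi>;
                \<xi> = (\<lambda>n \<omega>. w (X (n - 1) \<omega>) (X n \<omega>));
                Sn = (\<lambda>n \<omega>. \<Sum>k = 1..n. \<xi> k \<omega>)
            in (AE \<omega> in \<Omega>. (\<lambda>n. Sn n \<omega> / real n) \<longlonglongrightarrow> \<mu>) \<and>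
               (\<sigma>2 > 0 \<longrightarrow>
                  weak_conv_m
                    (\<lambda>n. distr \<Omega> borel (\<lambda>\<omega>. (Sn n \<omega> - real n * \<mu>) / sqrt (real n * \<sigma>2)))
                    std_normal_distribution))))"
proof -
  interpret torus: torus_chain M N p
    by unfold_locales (use assms(1-3) in auto)
  \<comment> \<open>The minorization holds on all of \<open>S\<close>, so initial laws charging the
    two inaccessible states are covered as well.\<close>
  obtain m b where "doeblin_matrix S P m b"
    unfolding S_def P_def by (rule torus.minorization)
  then interpret doeblin_matrix S P m b .
  have shift: "(\<Sum>k = 1..n. w (X (k - 1) \<omega>) (X k \<omega>)) = (\<Sum>k<n. w (X k \<omega>) (X (Suc k) \<omega>))"
    for n \<omega> and X :: "nat \<Rightarrow> 'w \<Rightarrow> config \<times> int"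
    by (simp add: sum.atLeast1_atMost_eq)
  show ?thesis
    unfolding Let_def shift
    using torus.irreducible torus.aperiodic ex1_stationary invertible_fundamental_base
      additive_functional_limits[where w = w]
    unfolding P_def[symmetric] by blast
qed

end
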